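(* Let $\Gamma$ be a connected circulant graph with valency $5$. Then $\Gamma$ is closed distance magic if and only if $\Gamma$ is isomorphic to $\mathrm{Cay}(\mathbb{Z}_n;\{\pm 1,\pm c,n/2\})$ for some even integer $n$ and some integer $c$ with $1<c<n/2$ such that one of the following (i)--(iv) holds: (i) $c=n/2-1$; (ii) $n\equiv 2 \pmod 4$, $c$ is even, and $2(c^2-1)$ is an odd multiple of $n$; (iii) $n=3\cdot 2^t(6k+(-1)^t)$ and $c=2^{t-1}(6k+(-1)^t)-1$ for some integer $t\ge 2$ and some integer $k\ge 0$ such that $c\ge 2$; (iv) $n=3\cdot 2^t(6k-(-1)^t)$ and $c=2^{t-1}(6k-(-1)^t)+1$ for some integer $t\ge 2$ and some integer $k\ge 0$ such that $c\ge 2$.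
   Context: All graphs are finite, simple and undirected. For a finite group $G$ and an inverse-closed subset $S\subseteq G$ not containing the identity, the Cayley graph $\mathrm{Cay}(G;S)$ has vertex set $G$, with $g,h$ adjacent iff $h=gs$ for some $s\in S$; its valency is $|S|$. A circulant graph is a Cayley graph $\mathrm{Cay}(G;S)$ with $G$ a finite cyclic group, i.e. $\mathrm{Cay}(\mathbb{Z}_n;S)$ for some $n$ (written additively). For a vertex $u$, the closed neighborhood $N[u]$ consists of $u$ and all its neighbors. A closed distance magic labeling of a graph $\Gamma=(V,E)$ of order $n=|V|$ is a bijection $\ell:V\to\{1,2,\ldots,n\}$ for which there is a positive integer $r$ with $\sum_{x\in N[u]}\ell(x)=r$ for all $u\in V$. A graph is closed distance magic if it admits a closed distance magic labeling. *)

theory Defs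
  imports "HOL-Algebra.Elementary_Groups" "HOL-Number_Theory.Cong" "Graph_Theory.Graph_Theory"
begin

text \<open>
  As in \<^theory>\<open>Graph_Theory.Pair_Digraph\<close>, a finite simple undirected graph is a finite,
  loopfree, symmetric pair digraph (locale \<^locale>\<open>pair_graph\<close>).
\<close>

definition connection_set :: "('a, 'm) monoid_scheme \<Rightarrow> 'a set \<Rightarrow> bool" where
  "connection_set G S \<longleftrightarrow>
     S \<subseteq> carrier G \<and> \<one>\<^bsub>G\<^esub> \<notin> S \<and> (\<forall>s\<in>S. inv\<^bsub>G\<^esub> s \<in> S)"

definition cayley_graph :: "('a, 'm) monoid_scheme \<Rightarrow> 'a set \<Rightarrow> 'a pair_pre_digraph" where
  "cayley_graph G S =
     \<lparr> pverts = carrier G,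
       parcs = {(g, h). g \<in> carrier G \<and> h \<in> carrier G \<and> (\<exists>s\<in>S. h = g \<otimes>\<^bsub>G\<^esub> s)} \<rparr>"

lemma pair_graph_cayley_graph:
  assumes "group G" "finite (carrier G)" "connection_set G S"
  shows "pair_graph (cayley_graph G S)"
proof -
  interpret group G by fact
  have S: "S \<subseteq> carrier G" "\<one>\<^bsub>G\<^esub> \<notin> S" "\<And>s. s \<in> S \<Longrightarrow> inv\<^bsub>G\<^esub> s \<in> S"
    using assms(3) by (auto simp: connection_set_def)
  show ?thesis
  proof
    have "parcs (cayley_graph G S) \<subseteq> carrier G \<times> carrier G"
      by (auto simp: cayley_graph_def)
    then show "finite (parcs (cayley_graph G S))"
      using assms(2) by (meson finite_SigmaI finite_subset)
  next
    fix e assume "e \<in> parcs (cayley_graph G S)"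
    then show "fst e \<noteq> snd e"
      using S by (auto simp: cayley_graph_def)
  next
    have "(h, g) \<in> parcs (cayley_graph G S)" if "(g, h) \<in> parcs (cayley_graph G S)" for g h
    proof -
      from that obtain s where s: "s \<in> S" "h = g \<otimes>\<^bsub>G\<^esub> s" "g \<in> carrier G" "h \<in> carrier G"
        by (auto simp: cayley_graph_def)
      then have "g = h \<otimes>\<^bsub>G\<^esub> inv\<^bsub>G\<^esub> s"
        using S(1) by (auto simp: m_assoc)
      with s S(3) show ?thesis by (auto simp: cayley_graph_def)
    qed
    then have "sym (parcs (cayley_graph G S))" by (rule symI)
    then show "symmetric (with_proj (cayley_graph G S))"
      by (simp add: symmetric_def)
  qed (use assms(2) in \<open>auto simp: cayley_graph_def\<close>)
qed

definition closed_neighborhood :: "'a pair_pre_digraph \<Rightarrow> 'a \<Rightarrow> 'a set" where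
  "closed_neighborhood \<Gamma> u = insert u {v \<in> pverts \<Gamma>. (u, v) \<in> parcs \<Gamma>}"

definition closed_distance_magic_labeling :: "'a pair_pre_digraph \<Rightarrow> ('a \<Rightarrow> nat) \<Rightarrow> bool" where
  "closed_distance_magic_labeling \<Gamma> l \<longleftrightarrow>
     bij_betw l (pverts \<Gamma>) {1..card (pverts \<Gamma>)} \<and>
     (\<exists>r>0. \<forall>u\<in>pverts \<Gamma>. (\<Sum>x\<in>closed_neighborhood \<Gamma> u. l x) = r)"

definition closed_distance_magic :: "'a pair_pre_digraph \<Rightarrow> bool" where
  "closed_distance_magic \<Gamma> \<longleftrightarrow> (\<exists>l. closed_distance_magic_labeling \<Gamma> l)"

end

theory Submission
  imports Defs "HOL-Algebra.Multiplicative_Group" "HOL-Computational_Algebra.Polynomial"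
begin

text \<open>
  Write the connection set as \<open>{\<plusminus>a, \<plusminus>b, m}\<close> in \<open>\<int>/n\<close> with \<open>n = 2 m\<close>.

  Necessity. After centering, a labeling is an integer function \<open>f\<close>, injective on \<open>\<int>/n\<close>, that is
  annihilated by the shift operator with exponents \<open>0, \<plusminus>a, \<plusminus>b, m\<close>. Raising this operator to the
  \<open>p\<close>-th power modulo a large prime \<open>p\<close> shows that \<open>f\<close> is annihilated by all its dilations by units
  \<open>k\<close>; this replaces the irreducibility of cyclotomic polynomials. Hence every frequency \<open>j\<close> of \<open>f\<close>
  satisfies \<open>1 + (-1)^j + 2 cos (2\<pi>kja/n) + 2 cos (2\<pi>kjb/n) = 0\<close> for all units \<open>k\<close>. For odd \<open>j\<close> this says
  that \<open>j (a + b)\<close> or \<open>j (a - b)\<close> is \<open>m\<close> modulo \<open>n\<close>; for even \<open>j\<close> both cosines are nonpositive for all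
  \<open>k\<close>, so \<open>ja\<close> and \<open>jb\<close> have orders 3 and 3, or 2 and 4. Injectivity of \<open>f\<close> provides, for each prime
  \<open>p\<close> dividing \<open>n\<close>, a frequency not divisible by \<open>p\<close>. This makes \<open>a\<close> or \<open>b\<close> a unit, and multiplying
  by its inverse gives \<open>{\<plusminus>1, \<plusminus>c, m}\<close> with \<open>c\<close> as in the statement.

  Sufficiency. In case (i) label antipodal vertices complementarily; in case (ii) split \<open>\<int>/n\<close> as
  \<open>\<int>/2 \<times> \<int>/d1 \<times> \<int>/d2\<close> with \<open>d1\<close> dividing \<open>c - 1\<close> and \<open>d2\<close> dividing \<open>c + 1\<close>; in cases (iii) and
  (iv), where \<open>n = 6 q\<close>, add a function of \<open>x mod 3\<close> to three times an antipodal labeling of \<open>\<int>/2q\<close>.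
\<close>

section \<open>Dilating a vanishing shift sum by a unit\<close>

text \<open>The inner binomial coefficients of a \<open>p\<close>-th power are multiples of
  \<open>p\<close>, so taking \<open>p\<close>-th powers is additive modulo \<open>p\<close>. The
  error is an explicit multiple of \<open>p\<close> because the lemma is applied in the ring
  \<open>int poly\<close>.\<close>

lemma sum_power_prime:
  fixes u :: "'i \<Rightarrow> 'a::comm_ring_1"
  assumes "prime p" "finite I"
  shows "\<exists>w. (\<Sum>i\<in>I. u i) ^ p = (\<Sum>i\<in>I. u i ^ p) + of_nat p * w"
  using assms(2)
proof (induction I rule: finite_induct)
  case empty
  have "(0::'a) ^ p = 0" using prime_gt_0_nat[OF assms(1)] by (simp add: power_0_left)
  then show ?case by (intro exI[of _ 0]) simp
next
  case (insert i I)
  have binom: "\<exists>w. (a + b) ^ p = a ^ p + b ^ p + of_nat p * w" for a b :: 'a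
  proof -
    have p0: "p > 0" using prime_gt_0_nat[OF assms(1)] .
    have "{..p} = insert 0 (insert p {0<..<p})" using p0 by auto
    then have "(a + b) ^ p = a ^ p + b ^ p + (\<Sum>k\<in>{0<..<p}. of_nat (p choose k) * a ^ k * b ^ (p - k))"
      using p0 by (simp add: binomial_ring algebra_simps)
    also have "(\<Sum>k\<in>{0<..<p}. of_nat (p choose k) * a ^ k * b ^ (p - k)) =
        of_nat p * (\<Sum>k\<in>{0<..<p}. of_nat ((p choose k) div p) * a ^ k * b ^ (p - k))"
      unfolding sum_distrib_left
    proof (rule sum.cong)
      fix k assume k: "k \<in> {0<..<p}"
      have "p dvd (p choose k)"
        using k assms(1) by (intro dvd_choose_prime) auto
      then have "of_nat (p choose k) = (of_nat p * of_nat ((p choose k) div p) :: 'a)"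
        by (metis dvd_mult_div_cancel of_nat_mult)
      then show "of_nat (p choose k) * a ^ k * b ^ (p - k) =
          of_nat p * (of_nat ((p choose k) div p) * a ^ k * b ^ (p - k))"
        by (simp add: algebra_simps)
    qed auto
    finally show ?thesis by blast
  qed
  obtain w where w: "(\<Sum>i\<in>I. u i) ^ p = (\<Sum>i\<in>I. u i ^ p) + of_nat p * w"
    using insert.IH by blast
  obtain w' where "(u i + (\<Sum>i\<in>I. u i)) ^ p = u i ^ p + (\<Sum>i\<in>I. u i) ^ p + of_nat p * w'"
    using binom by blast
  with w insert.hyps show ?case
    by (intro exI[of _ "w + w'"]) (simp add: algebra_simps)
qed

section \<open>Integer polynomials acting as polynomials in the shift operator\<close>

definition shift_action :: "int poly \<Rightarrow> (int \<Rightarrow> int) \<Rightarrow> int \<Rightarrow> int" where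
  "shift_action Q f x = (\<Sum>i\<le>degree Q. coeff Q i * f (x + int i))"

lemma shift_action_bound:
  assumes "degree Q \<le> N"
  shows "shift_action Q f x = (\<Sum>i\<le>N. coeff Q i * f (x + int i))"
  unfolding shift_action_def
  using assms by (intro sum.mono_neutral_left) (auto simp: coeff_eq_0)

lemma shift_action_0 [simp]: "shift_action 0 f x = 0"
  by (simp add: shift_action_def)

lemma shift_action_add:
  "shift_action (P + Q) f x = shift_action P f x + shift_action Q f x"
  using shift_action_bound[of "P + Q" "max (degree P) (degree Q)"]
    shift_action_bound[of P "max (degree P) (degree Q)"]
    shift_action_bound[of Q "max (degree P) (degree Q)"]
  by (simp add: degree_add_le sum.distrib algebra_simps)

lemma shift_action_sum:
  "shift_action (\<Sum>i\<in>I. Q i) f x = (\<Sum>i\<in>I. shift_action (Q i) f x)"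
  by (induction I rule: infinite_finite_induct) (auto simp: shift_action_add)

lemma shift_action_smult: "shift_action (smult c Q) f x = c * shift_action Q f x"
  using shift_action_bound[of "smult c Q" "degree Q"]
  by (simp add: shift_action_def sum_distrib_left algebra_simps)

lemma shift_action_monom [simp]: "shift_action (monom c k) f x = c * f (x + int k)"
proof -
  have "shift_action (monom c k) f x = (\<Sum>i\<le>k. coeff (monom c k) i * f (x + int i))"
    by (intro shift_action_bound degree_monom_le)
  also have "\<dots> = (\<Sum>i\<le>k. if i = k then c * f (x + int k) else 0)"
    by (intro sum.cong) auto
  finally show ?thesis by simp
qed

lemma shift_action_pCons: "shift_action (pCons c Q) f x = c * f x + shift_action Q f (x + 1)"
proof -
  have "shift_action (pCons c Q) f x = (\<Sum>i\<le>Suc (degree Q). coeff (pCons c Q) i * f (x + int i))"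
    by (intro shift_action_bound degree_pCons_le)
  then show ?thesis
    unfolding sum.atMost_Suc_shift by (simp add: shift_action_def algebra_simps)
qed

text \<open>The polynomials annihilating \<open>f\<close> form an ideal: peel off the constant
  coefficient of \<open>Q\<close>; the remaining factor X only moves the argument by one.\<close>

lemma shift_action_mult_eq_0:
  assumes "\<And>x. shift_action P f x = 0"
  shows "shift_action (Q * P) f x = 0"
proof (induction Q arbitrary: x)
  case (pCons c Q)
  have "pCons c Q * P = smult c P + pCons 0 (Q * P)" by simp
  then show ?case
    using assms pCons by (simp add: shift_action_add shift_action_smult shift_action_pCons)
qed simp

text \<open>The polynomial \<open>P\<close> with exponents \<open>s i\<close> annihilates
  \<open>f\<close>, hence so does \<open>P ^ p\<close>, which modulo \<open>p\<close> is the
  polynomial with exponents \<open>p * s i\<close>.\<close>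

lemma prime_dvd_dilated_sum_nat:
  fixes s :: "'i \<Rightarrow> nat" and f :: "int \<Rightarrow> int"
  assumes "prime p" "finite I" "\<And>x. (\<Sum>i\<in>I. f (x + int (s i))) = 0"
  shows "int p dvd (\<Sum>i\<in>I. f (x + int p * int (s i)))"
proof -
  define P :: "int poly" where "P = (\<Sum>i\<in>I. monom 1 (s i))"
  have P: "shift_action P f x = 0" for x
    unfolding P_def shift_action_sum using assms(3) by simp
  obtain w where w: "P ^ p = (\<Sum>i\<in>I. monom 1 (s i) ^ p) + of_nat p * w"
    unfolding P_def using sum_power_prime[OF assms(1,2)] by blast
  have "P ^ p = P ^ (p - 1) * P"
    using prime_gt_0_nat[OF assms(1)] by (simp add: power_eq_if mult.commute)
  then have "shift_action (P ^ p) f x = 0"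
    using shift_action_mult_eq_0[OF P] by simp
  moreover have "shift_action (of_nat p * w) f x = int p * shift_action w f x"
    using shift_action_smult[of "int p" w f x] by (simp add: of_nat_poly)
  ultimately have "(\<Sum>i\<in>I. f (x + int p * int (s i))) = - int p * shift_action w f x"
    unfolding w shift_action_add shift_action_sum
    by (simp add: monom_power algebra_simps)
  then show ?thesis by simp
qed

lemma prime_dvd_dilated_sum:
  fixes s :: "'i \<Rightarrow> int" and f :: "int \<Rightarrow> int"
  assumes "prime p" "finite I" "\<And>x. (\<Sum>i\<in>I. f (x + s i)) = 0"
  shows "int p dvd (\<Sum>i\<in>I. f (x + int p * s i))"
proof -
  \<comment> \<open>Exponents must be natural numbers: adding \<open>C\<close> makes all of them
    nonnegative, and starting at \<open>x - int p * C\<close> compensates after the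
    dilation.\<close>
  define C where "C = (\<Sum>i\<in>I. \<bar>s i\<bar>)"
  have C: "0 \<le> s i + C" if "i \<in> I" for i
  proof -
    have "\<bar>s i\<bar> \<le> C" unfolding C_def using assms(2) that by (intro member_le_sum) auto
    then show ?thesis by linarith
  qed
  have "(\<Sum>i\<in>I. f (y + int (nat (s i + C)))) = 0" for y
  proof -
    have "(\<Sum>i\<in>I. f (y + int (nat (s i + C)))) = (\<Sum>i\<in>I. f ((y + C) + s i))"
      using C by (intro sum.cong) (auto simp: algebra_simps)
    then show ?thesis using assms(3) by simp
  qed
  from prime_dvd_dilated_sum_nat[OF assms(1,2) this]
  have "int p dvd (\<Sum>i\<in>I. f ((x - int p * C) + int p * int (nat (s i + C))))" .
  also have "(\<Sum>i\<in>I. f ((x - int p * C) + int p * int (nat (s i + C)))) = (\<Sum>i\<in>I. f (x + int p * s i))"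
    using C by (intro sum.cong) (auto simp: algebra_simps)
  finally show ?thesis .
qed

text \<open>The dilated sum is a multiple of \<open>p\<close> of absolute value below
  \<open>p\<close>.\<close>

lemma dilation_by_large_prime:
  fixes s :: "'i \<Rightarrow> int" and f :: "int \<Rightarrow> int"
  assumes "prime p" "finite I" "\<And>x. (\<Sum>i\<in>I. f (x + s i)) = 0"
    and "\<And>x. \<bar>f x\<bar> \<le> M" "int (card I) * M < int p"
  shows "(\<Sum>i\<in>I. f (x + int p * s i)) = 0"
proof (rule ccontr)
  assume ne: "(\<Sum>i\<in>I. f (x + int p * s i)) \<noteq> 0"
  have "\<bar>\<Sum>i\<in>I. f (x + int p * s i)\<bar> \<le> (\<Sum>i\<in>I. \<bar>f (x + int p * s i)\<bar>)" by (rule sum_abs)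
  also have "\<dots> \<le> (\<Sum>i\<in>I. M)" by (intro sum_mono assms(4))
  finally have "\<bar>\<Sum>i\<in>I. f (x + int p * s i)\<bar> < int p" using assms(5) by simp
  then show False
    using prime_dvd_dilated_sum[OF assms(1-3)] ne
    by (metis dvd_imp_le_int linorder_not_less abs_of_nat)
qed

text \<open>Prime factors of \<open>k\<close> are split off one at a time. The sum dilated by
  \<open>p\<close> satisfies the same hypothesis with \<open>p * s i\<close>, so the induction
  generalizes over \<open>s\<close>.\<close>

lemma dilation_by_large_primes:
  fixes s :: "'i \<Rightarrow> int" and f :: "int \<Rightarrow> int"
  assumes "finite I" "\<And>x. (\<Sum>i\<in>I. f (x + s i)) = 0" "\<And>x. \<bar>f x\<bar> \<le> M"
    and "k > 0" "\<And>p. prime p \<Longrightarrow> p dvd k \<Longrightarrow> int (card I) * M < int p"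
  shows "(\<Sum>i\<in>I. f (x + int k * s i)) = 0"
  using assms(4,5,2)
proof (induction k arbitrary: s x rule: less_induct)
  case (less k)
  show ?case
  proof (cases "k = 1")
    case False
    then obtain p k' where p: "prime p" "k = p * k'"
      using prime_factor_nat by (metis dvdE)
    have "(\<Sum>i\<in>I. f (y + int p * s i)) = 0" for y
      using p less.prems by (intro dilation_by_large_prime[OF p(1) assms(1) _ assms(3)]) auto
    moreover have "k' < k" "0 < k'" using p less.prems(1) prime_gt_1_nat by auto
    ultimately have "(\<Sum>i\<in>I. f (x + int k' * (int p * s i))) = 0"
      using p less.prems by (intro less.IH[of k' "\<lambda>i. int p * s i" x]) auto
    then show ?thesis by (simp add: p(2) algebra_simps)
  qed (use less.prems in simp)
qed

text \<open>An elementary substitute for Dirichlet's theorem. With \<open>t\<close> the product of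
  the primes dividing \<open>M\<close> but not \<open>k\<close>, every prime divisor of
  \<open>M\<close> divides exactly one of \<open>k\<close> and \<open>n * t\<close>.\<close>

lemma coprime_in_progression:
  fixes k n M :: nat
  assumes "coprime k n" "M > 0"
  obtains t where "coprime (k + n * t) M" "t > 0"
proof
  define t where "t = \<Prod>{q. prime q \<and> q dvd M \<and> \<not> q dvd k}"
  have fin: "finite {q. prime q \<and> q dvd M \<and> \<not> q dvd k}"
    by (rule finite_subset[of _ "{..M}"]) (use assms(2) dvd_imp_le in auto)
  show "t > 0" unfolding t_def by (intro prod_pos) (auto intro: prime_gt_0_nat)
  show "coprime (k + n * t) M"
  proof (rule ccontr)
    assume "\<not> coprime (k + n * t) M"
    then obtain q where q: "prime q" "q dvd k + n * t" "q dvd M"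
      by (metis coprime_iff_gcd_eq_1 gcd_greatest_iff prime_factor_nat dvd_refl)
    show False
    proof (cases "q dvd k")
      case True
      then have "q dvd n * t" using q(2) by (simp add: dvd_add_right_iff)
      moreover have "\<not> q dvd n"
        using assms(1) True q(1) by (metis coprime_common_divisor not_prime_unit)
      ultimately have "q dvd t" using q(1) prime_dvd_mult_iff by blast
      then obtain r where r: "prime r" "\<not> r dvd k" "q dvd r"
        unfolding t_def using prime_dvd_prod_iff[OF fin q(1)] by auto
      then show False using True q(1) primes_dvd_imp_eq by blast
    next
      case False
      then have "q dvd t" unfolding t_def using fin q
        by (intro dvd_prodI) auto
      then show False using False q(2) by (simp add: dvd_add_left_iff)
    qed
  qed
qed

text \<open>Periodicity allows \<open>k\<close> to be replaced by some \<open>k + n * t\<close>,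
  chosen so that all its prime factors are large compared with the values of
  \<open>f\<close>.\<close>

lemma dilation_by_unit:
  fixes s :: "'i \<Rightarrow> int" and f :: "int \<Rightarrow> int"
  assumes "finite I" "\<And>x. (\<Sum>i\<in>I. f (x + s i)) = 0"
    and periodic: "\<And>x y. f (x + int n * y) = f x" and "n > 0" "coprime k n"
  shows "(\<Sum>i\<in>I. f (x + int k * s i)) = 0"
proof -
  define M where "M = Max ((\<lambda>x. \<bar>f x\<bar>) ` {0..<int n})"
  have M: "\<bar>f x\<bar> \<le> M" for x
  proof -
    have "f x = f (x mod int n)"
      using periodic[of "x mod int n" "x div int n"] by (simp add: mod_mult_div_eq)
    then show ?thesis unfolding M_def using assms(4) by (intro Max_ge) auto
  qed
  \<comment> \<open>Coprimality to this factorial excludes all prime factors up to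
    \<open>card I * M\<close>.\<close>
  obtain t where t: "coprime (k + n * t) (fact (nat (int (card I) * M)) :: nat)" "t > 0"
    using coprime_in_progression[OF assms(5)] by (metis fact_gt_zero)
  have "(\<Sum>i\<in>I. f (x + int (k + n * t) * s i)) = 0"
  proof (rule dilation_by_large_primes[OF assms(1,2) M])
    show "0 < k + n * t" using assms(4) t by simp
  next
    fix p :: nat assume p: "prime p" "p dvd k + n * t"
    show "int (card I) * M < int p"
    proof (rule ccontr)
      assume "\<not> int (card I) * M < int p"
      then have "p \<le> nat (int (card I) * M)" by linarith
      then have "p dvd fact (nat (int (card I) * M))"
        using p(1) by (intro dvd_fact) (auto simp: Suc_le_eq prime_gt_0_nat)
      then show False using t(1) p by (metis coprime_common_divisor not_prime_unit)
    qed
  qed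
  moreover have "f (x + int (k + n * t) * s i) = f (x + int k * s i)" for i
    using periodic[of "x + int k * s i" "int t * s i"] by (simp add: algebra_simps)
  ultimately show ?thesis by simp
qed

section \<open>Fourier analysis of magic labelings\<close>

lemma sum_cis_multiples_eq_0:
  assumes "n > 0" "\<not> int n dvd x"
  shows "(\<Sum>j\<in>{0..<int n}. cis (2 * pi * real_of_int (j * x) / real n)) = 0"
proof -
  define z where "z = cis (2 * pi * real_of_int x / real n)"
  have pw: "z ^ j = cis (2 * pi * real_of_int (int j * x) / real n)" for j
    unfolding z_def DeMoivre by (simp add: algebra_simps)
  have "z \<noteq> 1"
  proof
    assume "z = 1"
    then have "cos (2 * pi * real_of_int x / real n) = 1"
      unfolding z_def by (metis cis.simps(1) one_complex.simps(1))
    then obtain t :: int where "2 * pi * real_of_int x / real n = real_of_int t * 2 * pi"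
      using cos_one_2pi_int by auto
    then have "real_of_int x = real_of_int (int n * t)"
      using assms(1) by (simp add: field_simps)
    then have "x = int n * t" by linarith
    with assms(2) show False by simp
  qed
  moreover have "z ^ n = 1"
    unfolding pw using assms(1) cis_multiple_2pi[of "real_of_int x"] by (simp add: mult.assoc)
  ultimately have "(\<Sum>j<n. z ^ j) = 0" by (simp add: geometric_sum)
  also have "(\<Sum>j<n. z ^ j) = (\<Sum>j\<in>{0..<int n}. cis (2 * pi * real_of_int (j * x) / real n))"
    by (rule sum.reindex_bij_witness[of _ nat int]) (auto simp: pw)
  finally show ?thesis .
qed

lemma sum_periodic_shift:
  fixes g :: "int \<Rightarrow> 'a::comm_monoid_add"
  assumes "n > 0" "\<And>x y. g (x + n * y) = g x"
  shows "(\<Sum>x\<in>{0..<n}. g (x + s)) = (\<Sum>x\<in>{0..<n}. g x)"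
proof (rule sum.reindex_bij_witness[of _ "\<lambda>x. (x - s) mod n" "\<lambda>x. (x + s) mod n"])
  fix x show "g ((x + s) mod n) = g (x + s)"
    using assms(2)[of "(x + s) mod n" "(x + s) div n"] by (simp add: mod_mult_div_eq)
qed (use assms(1) in \<open>auto simp: mod_simps\<close>)

lemma cis_int_cong:
  assumes "n > 0" "[x = y] (mod int n)"
  shows "cis (2 * pi * real_of_int x / real n) = cis (2 * pi * real_of_int y / real n)"
proof -
  obtain t where "x = y + int n * t"
    using assms(2) by (metis cong_iff_lin cong_sym)
  then have "2 * pi * real_of_int x / real n = 2 * pi * real_of_int y / real n + 2 * pi * real_of_int t"
    using assms(1) by (simp add: field_simps)
  then show ?thesis by (simp add: cis_mult[symmetric] cis_multiple_2pi)
qed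

definition fourier :: "nat \<Rightarrow> (int \<Rightarrow> int) \<Rightarrow> int \<Rightarrow> complex" where
  "fourier n f j = (\<Sum>x\<in>{0..<int n}. of_int (f x) * cis (2 * pi * real_of_int (j * x) / real n))"

lemma fourier_shift:
  assumes "n > 0" and periodic: "\<And>x y. f (x + int n * y) = f x"
  shows "fourier n (\<lambda>x. f (x + s)) j = cis (- 2 * pi * real_of_int (j * s) / real n) * fourier n f j"
proof -
  define g where "g x = of_int (f x) * cis (2 * pi * real_of_int (j * x) / real n)" for x
  have g: "g (x + int n * y) = g x" for x y
    unfolding g_def periodic
    by (subst cis_int_cong[OF assms(1), of "j * (x + int n * y)" "j * x"])
      (auto simp: cong_iff_dvd_diff algebra_simps)
  have "cis (- 2 * pi * real_of_int (j * s) / real n) * fourier n f j =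
      cis (- 2 * pi * real_of_int (j * s) / real n) * (\<Sum>x\<in>{0..<int n}. g (x + s))"
    using sum_periodic_shift[of "int n" g s] assms(1) g by (simp add: g_def fourier_def)
  also have "\<dots> = fourier n (\<lambda>x. f (x + s)) j"
    unfolding fourier_def sum_distrib_left
  proof (intro sum.cong refl)
    fix x
    have "- 2 * pi * real_of_int (j * s) / real n + 2 * pi * real_of_int (j * (x + s)) / real n =
        2 * pi * real_of_int (j * x) / real n"
      using assms(1) by (simp add: field_simps)
    then show "cis (- 2 * pi * real_of_int (j * s) / real n) * g (x + s) =
        of_int (f (x + s)) * cis (2 * pi * real_of_int (j * x) / real n)"
      unfolding g_def by (metis cis_mult mult.left_commute)
  qed
  finally show ?thesis by simp
qed

text \<open>Orthogonality of the characters leaves only the term \<open>x = 0\<close>. Recovering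
  this one value suffices, since the lemma is applied to a difference of two translates.\<close>

lemma fourier_inversion:
  assumes "n > 0"
  shows "(\<Sum>j\<in>{0..<int n}. fourier n f j) = of_nat n * of_int (f 0)"
proof -
  have "(\<Sum>j\<in>{0..<int n}. fourier n f j) =
      (\<Sum>x\<in>{0..<int n}. of_int (f x) * (\<Sum>j\<in>{0..<int n}. cis (2 * pi * real_of_int (j * x) / real n)))"
    unfolding fourier_def by (subst sum.swap) (simp add: sum_distrib_left)
  also have "\<dots> = (\<Sum>x\<in>{0..<int n}. if x = 0 then of_nat n * of_int (f 0) else 0)"
  proof (intro sum.cong refl)
    fix x assume x: "x \<in> {0..<int n}"
    show "of_int (f x) * (\<Sum>j\<in>{0..<int n}. cis (2 * pi * real_of_int (j * x) / real n)) =
        (if x = 0 then of_nat n * of_int (f 0) else 0)"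
    proof (cases "x = 0")
      case False
      then have "\<not> int n dvd x" using x zdvd_not_zless by auto
      then show ?thesis using sum_cis_multiples_eq_0[OF assms] False by simp
    qed simp
  qed
  finally show ?thesis using assms by simp
qed

text \<open>If every frequency of \<^term>\<open>f\<close> were divisible by \<^term>\<open>p\<close>, then \<^term>\<open>f\<close> would
  have period \<^term>\<open>n div p\<close>.\<close>

lemma exists_frequency_not_dvd:
  assumes "n > 0" "prime p" "p dvd n"
    and periodic: "\<And>x y. f (x + int n * y) = f x"
    and inj: "\<And>x y. f x = f y \<Longrightarrow> int n dvd x - y"
  obtains j where "\<not> int p dvd j" "fourier n f j \<noteq> 0"
proof (rule ccontr)
  assume "\<not> thesis"
  with that have zero: "fourier n f j = 0" if "\<not> int p dvd j" for j using that by blast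
  obtain q where q: "n = p * q" using assms(3) by blast
  define D where "D x = f (x + int q) - f x" for x
  have "fourier n D j = 0" for j
  proof -
    have "fourier n D j = fourier n (\<lambda>x. f (x + int q)) j - fourier n f j"
      unfolding D_def fourier_def by (simp add: sum_subtractf algebra_simps)
    also have "\<dots> = (cis (- 2 * pi * real_of_int (j * int q) / real n) - 1) * fourier n f j"
      by (simp add: fourier_shift[OF assms(1) periodic] algebra_simps)
    also have "\<dots> = 0"
    \<comment> \<open>A frequency divisible by \<open>p\<close> does not see the shift by
      \<open>q = n / p\<close>; at all others the transform of \<open>f\<close> is zero by
      assumption.\<close>
    proof (cases "int p dvd j")
      case True
      then have "[- j * int q = 0] (mod int n)" by (auto simp: q cong_0_iff)
      from cis_int_cong[OF assms(1) this] show ?thesis by simp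
    qed (simp add: zero)
    finally show ?thesis .
  qed
  \<comment> \<open>Now \<open>f (int q) = f 0\<close>, and injectivity would make \<open>n\<close>
    divide its proper divisor \<open>q\<close>.\<close>
  with fourier_inversion[OF assms(1), of D] have "D 0 = 0" using assms(1) by simp
  then have "int n dvd int q" using inj[of "int q" 0] by (simp add: D_def)
  then have "p * q dvd 1 * q" using q by (simp flip: of_nat_mult)
  moreover have "q \<noteq> 0" using assms(1) q by auto
  ultimately have "p dvd 1" by (metis dvd_times_right_cancel_iff)
  then show False using assms(2) by (simp add: not_prime_unit)
qed

text \<open>Each shift multiplies the transform by a root of unity, so the vanishing shift sum
  transforms into \<open>fourier n f j\<close> times a sum of roots of unity. The latter must
  vanish, and its real part is the claim.\<close>

lemma sum_cos_eq_0_of_fourier: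
  assumes "n > 0" and periodic: "\<And>x y. f (x + int n * y) = f x"
    and sum: "\<And>x. (\<Sum>i\<in>I. f (x + s i)) = 0" and "fourier n f j \<noteq> 0"
  shows "(\<Sum>i\<in>I. cos (2 * pi * real_of_int (j * s i) / real n)) = 0"
proof -
  have "(\<Sum>i\<in>I. cis (- 2 * pi * real_of_int (j * s i) / real n)) * fourier n f j =
      (\<Sum>i\<in>I. fourier n (\<lambda>x. f (x + s i)) j)"
    by (simp add: fourier_shift[OF assms(1) periodic] sum_distrib_right)
  also have "\<dots> = (\<Sum>x\<in>{0..<int n}. of_int (\<Sum>i\<in>I. f (x + s i)) * cis (2 * pi * real_of_int (j * x) / real n))"
    unfolding fourier_def by (subst sum.swap) (simp add: sum_distrib_right)
  also have "\<dots> = 0" by (simp only: sum) simp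
  finally have "(\<Sum>i\<in>I. cis (- 2 * pi * real_of_int (j * s i) / real n)) = 0"
    using assms(4) by simp
  then have "Re (\<Sum>i\<in>I. cis (- 2 * pi * real_of_int (j * s i) / real n)) = 0" by simp
  then show ?thesis by simp
qed

section \<open>Residues whose unit multiples all have nonpositive cosine\<close>

lemma cos_int_cong:
  assumes "n > 0" "[x = y] (mod int n)"
  shows "cos (2 * pi * real_of_int x / real n) = cos (2 * pi * real_of_int y / real n)"
  using cis_int_cong[OF assms] by (metis cis.simps(1))

text \<open>After division by the gcd, \<open>y\<close> becomes invertible modulo
  \<open>n / gcd\<close>. It remains to lift its inverse to a unit modulo \<open>n\<close>.\<close>

lemma unit_multiple_eq_gcd:
  fixes y :: int and n :: nat
  assumes "n > 0"
  obtains k :: nat where "coprime k n" "[int k * y = gcd y (int n)] (mod int n)"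
proof -
  define g where "g = gcd y (int n)"
  have g: "g > 0" unfolding g_def using assms by simp
  obtain y' where y': "y = g * y'" using g_def by (meson dvdE gcd_dvd1)
  obtain N' where N': "int n = g * N'" using g_def by (meson dvdE gcd_dvd2)
  have N'pos: "N' > 0" using N' g assms by (metis of_nat_0_less_iff zero_less_mult_pos)
  have "coprime y' N'"
  proof -
    have "g * gcd y' N' = g"
      using g_def N' y' g by (metis abs_of_pos gcd_mult_distrib_int)
    then show ?thesis using g by (simp add: coprime_iff_gcd_eq_1)
  qed
  then obtain x where x: "[y' * x = 1] (mod N')" using cong_solve_coprime_int by blast
  define k0 where "k0 = nat (x mod N')"
  have k0: "[int k0 * y' = 1] (mod N')"
    using x N'pos unfolding k0_def by (simp add: cong_def mod_simps mult.commute)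
  then have "coprime (int k0) N'" by (metis coprime_iff_invertible_int)
  then have "coprime k0 (nat N')" using N'pos by (simp flip: coprime_int_iff)
  \<comment> \<open>The inverse matters only modulo \<open>N'\<close>, so multiples of
    \<open>N'\<close> may be added until it is coprime to all of \<open>n\<close>.\<close>
  then obtain t where t: "coprime (k0 + nat N' * t) n"
    using coprime_in_progression assms by blast
  have "[int (k0 + nat N' * t) * y' = 1] (mod N')"
    using k0 N'pos by (simp add: cong_def algebra_simps)
  then have "g * N' dvd g * (int (k0 + nat N' * t) * y' - 1)"
    by (metis cong_iff_dvd_diff mult_dvd_mono dvd_refl)
  moreover have "g * (int (k0 + nat N' * t) * y' - 1) = int (k0 + nat N' * t) * y - g"
    by (simp add: y' algebra_simps)
  ultimately have "[int (k0 + nat N' * t) * y = g] (mod int n)"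
    unfolding cong_iff_dvd_diff N' by (simp only:)
  then show ?thesis using that t g_def by blast
qed

text \<open>Let \<open>N\<close> be the order of \<open>y\<close> modulo \<open>n\<close>. A unit
  multiple of \<open>y\<close> has angle 2 pi / \<open>N\<close>, and nonpositivity of its cosine
  leaves only the orders 2, 3 and 4, where the cosine of \<open>y\<close> itself is known.\<close>

lemma cos_multiples_nonpos:
  fixes y :: int
  assumes "n > 0" "\<And>k. coprime k n \<Longrightarrow> cos (2 * pi * real_of_int (int k * y) / real n) \<le> 0"
  shows "int n dvd 2 * y \<and> \<not> int n dvd y \<and> cos (2 * pi * real_of_int y / real n) = - 1 \<or>
    int n dvd 3 * y \<and> \<not> int n dvd y \<and> cos (2 * pi * real_of_int y / real n) = - 1 / 2 \<or>
    int n dvd 4 * y \<and> \<not> int n dvd 2 * y \<and> cos (2 * pi * real_of_int y / real n) = 0"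
proof -
  define g where "g = gcd y (int n)"
  have g: "g > 0" unfolding g_def using assms by simp
  obtain y' where y': "y = g * y'" using g_def by (meson dvdE gcd_dvd1)
  obtain N' where N': "int n = g * N'" using g_def by (meson dvdE gcd_dvd2)
  have N'pos: "N' > 0" using N' g assms by (metis of_nat_0_less_iff zero_less_mult_pos)
  define N where "N = nat N'"
  have N: "int n = g * int N" "N > 0" using N' N'pos N_def by auto
  have cop: "coprime y' (int N)"
  proof -
    have "g * gcd y' (int N) = g"
      using g_def N y' g by (metis abs_of_pos gcd_mult_distrib_int)
    then show ?thesis using g by (simp add: coprime_iff_gcd_eq_1)
  qed
  have rn: "real n = real_of_int g * real N" using N(1) by (metis of_int_mult of_int_of_nat_eq)
  obtain k where k: "coprime k n" "[int k * y = g] (mod int n)"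
    using unit_multiple_eq_gcd[OF assms(1)] g_def by blast
  have "cos (2 * pi * real_of_int g / real n) \<le> 0"
    using assms(2)[OF k(1)] cos_int_cong[OF assms(1) k(2)] by simp
  then have c: "cos (2 * pi / real N) \<le> 0" using g N by (simp add: rn)
  have "N \<le> 4"
  proof (rule ccontr)
    assume "\<not> N \<le> 4"
    then have "2 * pi / real N < pi / 2" by (simp add: field_simps)
    then have "cos (2 * pi / real N) > 0" using N(2) by (intro cos_gt_zero) auto
    with c show False by simp
  qed
  moreover have "N \<noteq> 1" using c by auto
  ultimately have N234: "N = 2 \<or> N = 3 \<or> N = 4" using N(2) by auto
  have cosy: "cos (2 * pi * real_of_int y / real n) = cos (2 * pi * real_of_int y' / real N)"
    using g by (simp add: rn y' mult.assoc)
  have dvd: "int n dvd t * y \<longleftrightarrow> int N dvd t * y'" for t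
  proof -
    have "int n dvd t * y \<longleftrightarrow> g * int N dvd g * (t * y')" by (simp add: N(1) y' mult.left_commute)
    then show ?thesis using g by (simp only: dvd_times_left_cancel_iff)
  qed
  have cos_2: "cos (2 * pi * real_of_int y' / real N) = - 1" if "N = 2"
  proof -
    have "[y' = 1] (mod int N)" using cop that by (simp add: cong_def odd_iff_mod_2_eq_one)
    from cos_int_cong[OF N(2) this] that show ?thesis by simp
  qed
  have cos_3: "cos (2 * pi * real_of_int y' / real N) = - 1 / 2" if "N = 3"
  proof -
    have "\<not> 3 dvd y'" using cop that by (auto dest: coprime_common_divisor)
    then have "y' mod 3 = 1 \<or> y' mod 3 = 2" by presburger
    then have "[y' = 1] (mod int N) \<or> [y' = - 1] (mod int N)" using that by (auto simp: cong_def)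
    then show ?thesis
    proof
      assume "[y' = 1] (mod int N)"
      from cos_int_cong[OF N(2) this] that show ?thesis by (simp add: cos_120)
    next
      assume "[y' = - 1] (mod int N)"
      from cos_int_cong[OF N(2) this] that show ?thesis by (simp add: cos_120)
    qed
  qed
  have cos_4: "cos (2 * pi * real_of_int y' / real N) = 0" if "N = 4"
  proof -
    have "odd y'" using cop that by (auto dest: coprime_common_divisor)
    then obtain t where "y' = 2 * t + 1" by (elim oddE)
    then have "2 * pi * real_of_int y' / real N = real_of_int y' * (pi / 2)" "odd y'"
      using that by (auto simp: field_simps)
    then show ?thesis using cos_zero_iff_int by blast
  qed
  have nd: "\<not> int N dvd y'" "N = 4 \<Longrightarrow> \<not> int N dvd 2 * y'"
  proof -
    show "\<not> int N dvd y'"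
    proof
      assume "int N dvd y'"
      then have "is_unit (int N)" using coprime_common_divisor[OF cop _ dvd_refl] by simp
      then show False using \<open>N \<noteq> 1\<close> by simp
    qed
    show "\<not> int N dvd 2 * y'" if "N = 4"
    proof -
      have "odd y'" using cop that by (auto dest: coprime_common_divisor)
      then show ?thesis using that by presburger
    qed
  qed
  have nd1: "\<not> int n dvd y" using dvd[of 1] nd(1) by simp
  from N234 show ?thesis
  proof (elim disjE)
    assume N: "N = 2"
    then have "int n dvd 2 * y" unfolding dvd by simp
    with nd1 N cos_2 cosy show ?thesis by simp
  next
    assume N: "N = 3"
    then have "int n dvd 3 * y" unfolding dvd by simp
    with nd1 N cos_3 cosy show ?thesis by simp
  next
    assume N: "N = 4"
    then have "int n dvd 4 * y" "\<not> int n dvd 2 * y" unfolding dvd using nd(2) by simp_all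
    with N cos_4 cosy show ?thesis by simp
  qed
qed

text \<open>A cosine-free condition in the residues modulo \<open>2 * m\<close>. For odd
  \<open>j\<close> it says that the cosines at \<open>j * a\<close> and \<open>j * b\<close> cancel;
  for even \<open>j\<close>, that both residues have order 3, or that one has order 4 and the other
  an order dividing 2.\<close>

definition magic_frequency :: "int \<Rightarrow> int \<Rightarrow> int \<Rightarrow> int \<Rightarrow> bool" where
  "magic_frequency m a b j \<longleftrightarrow>
     odd j \<and> (\<exists>t. odd t \<and> (j * (a + b) = t * m \<or> j * (a - b) = t * m)) \<or>
     even j \<and> (2 * m dvd 3 * (j * a) \<and> 2 * m dvd 3 * (j * b) \<and> \<not> 2 * m dvd j * a \<and> \<not> 2 * m dvd j * b \<or>
       2 * m dvd 2 * (j * b) \<and> 2 * m dvd 4 * (j * a) \<and> \<not> 2 * m dvd 2 * (j * a) \<or>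
       2 * m dvd 2 * (j * a) \<and> 2 * m dvd 4 * (j * b) \<and> \<not> 2 * m dvd 2 * (j * b))"

lemma magic_frequency_of_fourier:
  fixes m :: nat and a b :: int and f :: "int \<Rightarrow> int"
  assumes "m > 0" and periodic: "\<And>x y. f (x + int (2 * m) * y) = f x"
    and sum: "\<And>x. f x + f (x + int m) + f (x + a) + f (x - a) + f (x + b) + f (x - b) = 0"
    and "fourier (2 * m) f j \<noteq> 0"
  shows "magic_frequency (int m) a b j"
proof -
  define n where "n = 2 * m"
  \<comment> \<open>The six offsets of a closed neighborhood.\<close>
  define s :: "nat \<Rightarrow> int" where "s i = [0, int m, a, - a, b, - b] ! i" for i
  define \<theta> where "\<theta> y = 2 * pi * real_of_int y / real n" for y
  have n: "n > 0" using assms(1) n_def by simp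
  have six: "{..<6::nat} = {0, 1, 2, 3, 4, 5}" by auto
  have "(\<Sum>i<6. f (x + s i)) = 0" for x
    using sum[of x] unfolding six s_def by (simp add: numeral_eq_Suc)
  then have dil: "(\<Sum>i<6. f (x + int k * s i)) = 0" if "coprime k n" for k x
    using dilation_by_unit[of "{..<6}" f s n k] periodic n that n_def by simp
  have "1 + cos (\<theta> (j * int k * int m)) + 2 * cos (\<theta> (int k * (j * a))) + 2 * cos (\<theta> (int k * (j * b))) = 0"
    if "coprime k n" for k
  proof -
    have "(\<Sum>i<6. cos (2 * pi * real_of_int (j * (int k * s i)) / real n)) = 0"
      using sum_cos_eq_0_of_fourier[OF n _ dil[OF that]] periodic assms(4) n_def by simp
    then show ?thesis
      unfolding six s_def \<theta>_def by (simp add: numeral_eq_Suc algebra_simps)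
  qed
  note * = this
  have half: "\<theta> (t * int m) = pi * real_of_int t" for t
    using assms(1) by (simp add: \<theta>_def n_def field_simps)
  show ?thesis
  proof (cases "odd j")
    case True
    \<comment> \<open>For odd \<open>j\<close> the offsets 0 and \<open>m\<close> cancel; the
      sum-to-product formula then makes half of one of the angles at \<open>j * (a + b)\<close>,
      \<open>j * (a - b)\<close> an odd multiple of pi / 2.\<close>
    then have "cos (\<theta> (j * int m)) = - 1" unfolding half by simp
    then have "cos (\<theta> (j * a)) + cos (\<theta> (j * b)) = 0" using *[of 1] by simp
    then have "cos ((\<theta> (j * a) + \<theta> (j * b)) / 2) * cos ((\<theta> (j * a) - \<theta> (j * b)) / 2) = 0"
      by (simp add: cos_plus_cos)
    moreover have "\<exists>t. odd t \<and> j * c = t * int m" if "cos (\<theta> (j * c) / 2) = 0" for c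
    proof -
      from that obtain t where t: "odd t" "\<theta> (j * c) / 2 = real_of_int t * (pi / 2)"
        using cos_zero_iff_int by auto
      then have "real_of_int (j * c) = real_of_int (t * int m)"
        using assms(1) by (simp add: \<theta>_def n_def field_simps)
      then have "j * c = t * int m" by linarith
      with t(1) show ?thesis by blast
    qed
    moreover have "\<theta> (j * a) + \<theta> (j * b) = \<theta> (j * (a + b))" "\<theta> (j * a) - \<theta> (j * b) = \<theta> (j * (a - b))"
      using n by (simp_all add: \<theta>_def field_simps)
    ultimately show ?thesis using True unfolding magic_frequency_def by (metis mult_eq_0_iff)
  next
    case False
    have e: "cos (\<theta> (int k * (j * a))) + cos (\<theta> (int k * (j * b))) = - 1" if "coprime k n" for k
    proof -
      obtain t where "j * int k = 2 * t" using False by (auto elim: evenE)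
      then have "cos (\<theta> (j * int k * int m)) = cos (2 * pi * real_of_int t)"
        unfolding half by (simp add: mult_ac)
      then have "cos (\<theta> (j * int k * int m)) = 1" by (simp only: cos_int_2pin)
      then show ?thesis using *[OF that] by linarith
    qed
    \<comment> \<open>Two cosines with sum -1 are both nonpositive, since neither is below -1. This
      holds for every unit \<open>k\<close>.\<close>
    have nonpos: "cos (2 * pi * real_of_int (int k * (j * a)) / real n) \<le> 0"
      "cos (2 * pi * real_of_int (int k * (j * b)) / real n) \<le> 0" if "coprime k n" for k
      using e[OF that] cos_ge_minus_one[of "\<theta> (int k * (j * a))"]
        cos_ge_minus_one[of "\<theta> (int k * (j * b))"]
      unfolding \<theta>_def by linarith+
    have "cos (\<theta> (j * a)) + cos (\<theta> (j * b)) = - 1" using e[of 1] by simp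
    moreover note cos_multiples_nonpos[OF n nonpos(1)] cos_multiples_nonpos[OF n nonpos(2)]
    \<comment> \<open>The possible values are -1, -1/2 and 0; only -1/2 with -1/2, or -1 with 0, add
      up to -1.\<close>
    ultimately show ?thesis
      using False unfolding magic_frequency_def \<theta>_def n_def by auto
  qed
qed

lemma magic_frequency_not_dvd:
  fixes m :: nat and a b :: int and f :: "int \<Rightarrow> int"
  assumes "m > 0" "\<And>x y. f (x + int (2 * m) * y) = f x"
    and "\<And>x y. f x = f y \<Longrightarrow> int (2 * m) dvd x - y"
    and "\<And>x. f x + f (x + int m) + f (x + a) + f (x - a) + f (x + b) + f (x - b) = 0"
    and "prime p" "p dvd 2 * m"
  obtains j where "\<not> int p dvd j" "magic_frequency (int m) a b j"
  using exists_frequency_not_dvd[of "2 * m" p f] magic_frequency_of_fourier[of m f a b] assms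
  by (metis mult_pos_pos zero_less_numeral)

section \<open>Arithmetic of the magic frequencies\<close>

text \<open>The four alternatives in exactly the form of the final theorem, so that they can be
  folded there.\<close>

definition circulant_condition :: "int \<Rightarrow> int \<Rightarrow> bool" where
  "circulant_condition n c \<longleftrightarrow>
    c = n div 2 - 1
    \<or> ([n = 2] (mod 4) \<and> even c \<and> (\<exists>m. odd m \<and> 2 * (c^2 - 1) = m * n))
    \<or> (\<exists>(t::nat) (k::int). t \<ge> 2 \<and> k \<ge> 0 \<and> c \<ge> 2 \<and>
         n = 3 * 2^t * (6 * k + (-1)^t) \<and> c = 2^(t - 1) * (6 * k + (-1)^t) - 1)
    \<or> (\<exists>(t::nat) (k::int). t \<ge> 2 \<and> k \<ge> 0 \<and> c \<ge> 2 \<and>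
         n = 3 * 2^t * (6 * k - (-1)^t) \<and> c = 2^(t - 1) * (6 * k - (-1)^t) + 1)"

section \<open>Recognizing the two families with powers of two\<close>

lemma even_int_decomp:
  fixes q :: int
  assumes "even q" "q > 0"
  obtains t :: nat and r :: int where "t \<ge> 2" "odd r" "r > 0" "q = 2 ^ (t - 1) * r"
proof -
  obtain r where r: "q = 2 ^ multiplicity 2 q * r" "\<not> 2 dvd r"
    using multiplicity_decompose'[of q 2] assms(2) by force
  have "multiplicity 2 q \<noteq> 0" using assms r by (metis power_0 mult_1)
  moreover have "r > 0" using assms(2) r(1) by (metis zero_less_mult_pos zero_less_numeral zero_less_power)
  ultimately show ?thesis
    using that[of "Suc (multiplicity 2 q)" r] r by auto
qed

lemma power_two_mod_three: "(2::int) ^ t mod 3 = (- 1) ^ t mod 3"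
proof -
  have "[2 = - 1] (mod (3::int))" by (simp add: cong_def)
  from cong_pow[OF this, of t] show ?thesis by (simp only: cong_def)
qed

lemma odd_mod_three:
  fixes r e :: int
  assumes "odd r" "r > 0" "e = 1 \<or> e = - 1" "r mod 3 = e mod 3"
  obtains k where "k \<ge> 0" "r = 6 * k + e"
proof
  have "(r - e) mod 6 = 0" using assms(1,3,4) by (elim disjE; simp; presburger)
  then show "r = 6 * ((r - e) div 6) + e" by presburger
  show "(r - e) div 6 \<ge> 0" using assms(2,3) by (intro pos_imp_zdiv_nonneg_iff[THEN iffD2]) auto
qed

lemma sign_mod_three:
  fixes r e s :: int
  assumes "e = 1 \<or> e = - 1" "s = 1 \<or> s = - 1" "(- e) mod 3 = (- s * r) mod 3"
  shows "r mod 3 = (e * s) mod 3"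
proof -
  have "3 dvd - e - - s * r" using assms(3) by (simp only: mod_eq_dvd_iff)
  then have "3 dvd s * (- e - - s * r)" by (rule dvd_mult)
  also have "s * (- e - - s * r) = r - e * s" using assms(2) by auto
  finally show ?thesis by (simp only: mod_eq_dvd_iff)
qed

text \<open>Here \<open>t - 1\<close> is the exponent of 2 in \<open>q\<close>. As 2 is -1 modulo 3,
  the residue of \<open>q\<close> forces the odd part to be \<open>e * (- 1) ^ t\<close> modulo 3,
  hence modulo 6. This is where the alternating sign in the families comes from.\<close>

lemma family_decomp:
  fixes q e :: int
  assumes "even q" "q > 0" "q mod 3 = (- e) mod 3" "e = 1 \<or> e = - 1"
  obtains t :: nat and k :: int where "t \<ge> 2" "k \<ge> 0" "q = 2 ^ (t - 1) * (6 * k + e * (- 1) ^ t)"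
proof -
  obtain t r where tr: "t \<ge> 2" "odd r" "r > 0" "q = 2 ^ (t - 1) * r"
    using even_int_decomp[OF assms(1,2)] .
  have sign: "(- 1 :: int) ^ (t - 1) = - ((- 1) ^ t)"
    using tr(1) by (cases t) auto
  have "(- e) mod 3 = (2 ^ (t - 1) mod 3) * r mod 3" using tr(4) assms(3) by (simp add: mod_simps)
  then have "(- e) mod 3 = (- 1) ^ (t - 1) * r mod 3" unfolding power_two_mod_three by (simp add: mod_simps)
  then have e: "(- e) mod 3 = (- ((- 1) ^ t) * r) mod 3" unfolding sign .
  have s: "(- 1 :: int) ^ t = 1 \<or> (- 1 :: int) ^ t = - 1" by (simp add: minus_one_power_iff)
  have "r mod 3 = (e * (- 1) ^ t) mod 3"
    using sign_mod_three[OF assms(4) s e] .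
  moreover have "e * (- 1) ^ t = 1 \<or> e * (- 1) ^ t = - 1"
    using assms(4) s by auto
  ultimately obtain k where "k \<ge> 0" "r = 6 * k + e * (- 1) ^ t" using odd_mod_three tr(2,3) by metis
  with tr that show ?thesis by blast
qed

lemma coprime_six_decomp:
  fixes x :: int
  assumes "\<not> 3 dvd x" "odd x"
  obtains e v where "e = 1 \<or> e = - 1" "x = e + 6 * v"
proof -
  have "x = 1 + 6 * (x div 6) \<or> x = - 1 + 6 * (x div 6 + 1)" using assms by presburger
  then show thesis using that by blast
qed

text \<open>Since \<open>e * q - 1 = e * (q - e)\<close>, both residues are \<open>q - e\<close> up
  to sign, and adding a nonzero multiple of \<open>6 * q\<close> leaves the allowed
  interval.\<close>

lemma bounded_residue:
  fixes c q e s :: int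
  assumes e: "e = 1 \<or> e = - 1"
    and s: "c - (e * q - 1) = 6 * q * s \<or> c - (1 - e * q) = 6 * q * s"
    and "1 < c" "c < 3 * q" "q \<ge> 2"
  shows "c = q - e"
proof -
  obtain X where X: "X = 6 * q * s" by blast
  have "X = 0 \<or> X \<ge> 6 * q \<or> X \<le> - (6 * q)"
  proof -
    have "s = 0 \<or> s \<ge> 1 \<or> s \<le> - 1" by linarith
    moreover have "6 * q * s \<ge> 6 * q * 1" if "s \<ge> 1"
      using assms(5) that by (intro mult_left_mono) auto
    moreover have "6 * q * s \<le> 6 * q * (- 1)" if "s \<le> - 1"
      using assms(5) that by (intro mult_left_mono) auto
    ultimately show ?thesis unfolding X by auto
  qed
  with e s[folded X] assms(3-5) show ?thesis by (elim disjE) simp_all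
qed

text \<open>The sign \<open>e\<close> treats both families at once: \<open>e = 1\<close> gives (iii)
  and \<open>e = - 1\<close> gives (iv).\<close>

lemma circulant_condition_six:
  assumes "even q" "q > 0" "e = 1 \<or> e = - 1" "q mod 3 = (- e) mod 3" "c = q - e" "c \<ge> 2"
  shows "circulant_condition (6 * q) c"
proof -
  obtain t k where tk: "t \<ge> 2" "k \<ge> 0" "q = 2 ^ (t - 1) * (6 * k + e * (- 1) ^ t)"
    using family_decomp[OF assms(1,2,4,3)] .
  have "(2::int) ^ t = 2 * 2 ^ (t - 1)" using tk(1) by (cases t) auto
  then have n: "6 * q = 3 * 2 ^ t * (6 * k + e * (- 1) ^ t)" using tk(3) by simp
  from assms(3) show ?thesis
  proof
    assume e: "e = 1"
    then have "6 * q = 3 * 2 ^ t * (6 * k + (- 1) ^ t)" "c = 2 ^ (t - 1) * (6 * k + (- 1) ^ t) - 1"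
      using n tk(3) assms(5) by simp_all
    with tk(1,2) assms(6) show ?thesis unfolding circulant_condition_def by blast
  next
    assume e: "e = - 1"
    then have "6 * q = 3 * 2 ^ t * (6 * k - (- 1) ^ t)" "c = 2 ^ (t - 1) * (6 * k - (- 1) ^ t) + 1"
      using n tk(3) assms(5) by simp_all
    with tk(1,2) assms(6) show ?thesis unfolding circulant_condition_def by blast
  qed
qed

text \<open>Multiply by the inverse \<open>u\<close> of \<open>a\<close>: it is odd, hence fixes
  \<open>m\<close> modulo \<open>2 * m\<close>, and it sends \<open>b\<close> to \<open>c\<close> up
  to sign.\<close>

lemma normalize_unit:
  fixes m a b :: int
  assumes "m > 0" "coprime a (2 * m)" "\<not> m dvd b" "\<not> 2 * m dvd a - b" "\<not> 2 * m dvd a + b"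
  obtains u c where "coprime u (2 * m)" "[u * a = 1] (mod 2 * m)" "1 < c" "c < m"
    "[c = u * b] (mod 2 * m) \<or> [c = - (u * b)] (mod 2 * m)"
    "(\<lambda>x. (u * x) mod (2 * m)) ` {a, - a, b, - b, m} = (\<lambda>x. x mod (2 * m)) ` {1, - 1, c, - c, m}"
proof -
  let ?n = "2 * m"
  obtain u where u: "[u * a = 1] (mod ?n)"
    using cong_solve_coprime_int[OF assms(2)] by (metis mult.commute)
  then have cop: "coprime u ?n" using coprime_iff_invertible_int by blast
  have um: "[u * m = m] (mod ?n)"
  proof -
    have "odd u" using cop by (auto dest: coprime_common_divisor)
    then obtain v where "u = 2 * v + 1" by (elim oddE)
    then have "u * m - m = v * ?n" by (simp add: algebra_simps)
    then show ?thesis unfolding cong_iff_dvd_diff by simp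
  qed
  define d where "d = (u * b) mod ?n"
  \<comment> \<open>Of the residues of \<open>u * b\<close> and its negative, \<open>c\<close> is
    the one in the lower half; the nondivisibility hypotheses exclude 0, 1 and
    \<open>m\<close>.\<close>
  define c where "c = (if d < m then d else ?n - d)"
  have d: "0 \<le> d" "d < ?n" "[d = u * b] (mod ?n)"
    unfolding d_def using assms(1) by (auto simp: cong_def)
  have cancel: "k dvd x" if "k dvd ?n" "k dvd u * x" for k x
    using cop that by (metis coprime_dvd_mult_right_iff coprime_divisors dvd_refl coprime_commute)
  have c: "[c = u * b] (mod ?n) \<or> [c = - (u * b)] (mod ?n)"
  proof (cases "d < m")
    case False
    then have "c - (- (u * b)) = ?n - (d - u * b)" by (simp add: c_def)
    then show ?thesis using d(3) unfolding cong_iff_dvd_diff by (metis dvd_diff dvd_refl)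
  qed (use d c_def in simp)
  have "\<not> m dvd d"
  proof
    assume "m dvd d"
    then have "m dvd u * b"
      using cong_dvd_iff[OF cong_dvd_modulus[OF d(3) dvd_triv_right]] by simp
    then show False using cancel[of m b] assms(3) by simp
  qed
  then have "d \<noteq> 0" "d \<noteq> m" by auto
  have "\<not> [d = u * a] (mod ?n)" "\<not> [d = - (u * a)] (mod ?n)"
  proof -
    show "\<not> [d = u * a] (mod ?n)"
    proof
      assume "[d = u * a] (mod ?n)"
      then have "[u * a = u * b] (mod ?n)" using cong_trans[OF cong_sym d(3)] by simp
      then have "?n dvd u * (a - b)" by (simp add: cong_iff_dvd_diff right_diff_distrib)
      then show False using cancel[of ?n "a - b"] assms(4) by simp
    qed
    show "\<not> [d = - (u * a)] (mod ?n)"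
    proof
      assume "[d = - (u * a)] (mod ?n)"
      then have "[- (u * a) = u * b] (mod ?n)" using cong_trans[OF cong_sym d(3)] by simp
      then have "?n dvd - (u * (a + b))" by (simp add: cong_iff_dvd_diff algebra_simps)
      then show False using cancel[of ?n "a + b"] assms(5) by simp
    qed
  qed
  moreover have "[- 1 = - (u * a)] (mod ?n)" using cong_sym[OF u] by (simp add: cong_minus_minus_iff)
  ultimately have nd: "\<not> [d = 1] (mod ?n)" "\<not> [d = - 1] (mod ?n)"
    using cong_trans[OF _ cong_sym[OF u]] cong_trans[of d "- 1" ?n "- (u * a)"] by blast+
  then have "d \<noteq> 1" "d \<noteq> ?n - 1" by (auto simp: cong_iff_dvd_diff)
  then have "1 < c" "c < m"
    using d \<open>d \<noteq> 0\<close> \<open>d \<noteq> m\<close> by (auto simp: c_def split: if_splits)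
  moreover have "(\<lambda>x. (u * x) mod ?n) ` {a, - a, b, - b, m} = (\<lambda>x. x mod ?n) ` {1, - 1, c, - c, m}"
  proof -
    have eq: "(u * a) mod ?n = 1 mod ?n" "(u * (- a)) mod ?n = (- 1) mod ?n" "(u * m) mod ?n = m mod ?n"
      using u um cong_minus_minus_iff[of "u * a" 1 ?n] by (auto simp: cong_def)
    from c have "(u * b) mod ?n = c mod ?n \<and> (u * (- b)) mod ?n = (- c) mod ?n \<or>
      (u * b) mod ?n = (- c) mod ?n \<and> (u * (- b)) mod ?n = c mod ?n"
    proof
      assume *: "[c = u * b] (mod ?n)"
      then have "[- c = - (u * b)] (mod ?n)" by (simp add: cong_minus_minus_iff)
      with * show ?thesis by (simp add: cong_def)
    next
      assume *: "[c = - (u * b)] (mod ?n)"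
      then have "[- c = u * b] (mod ?n)" using cong_minus_minus_iff[of c "- (u * b)"] by simp
      with * show ?thesis by (simp add: cong_def)
    qed
    then show ?thesis
    proof (elim disjE conjE)
      assume eq': "(u * b) mod ?n = c mod ?n" "(u * (- b)) mod ?n = (- c) mod ?n"
      show ?thesis unfolding image_insert image_empty eq eq' ..
    next
      assume eq': "(u * b) mod ?n = (- c) mod ?n" "(u * (- b)) mod ?n = c mod ?n"
      show ?thesis unfolding image_insert image_empty eq eq' by (simp only: insert_commute)
    qed
  qed
  ultimately show ?thesis using that cop u c by blast
qed

text \<open>The gcd of the three products is \<open>k\<close> up to sign. Connectedness of the graph
  enters the arithmetic through this gcd hypothesis.\<close>

lemma dvd_of_dvd_mult_gcd_eq_1:
  fixes M k a b m :: int
  assumes "gcd a (gcd b m) = 1" "M dvd k * a" "M dvd k * b" "M dvd k * m"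
  shows "M dvd k"
proof -
  have "M dvd gcd (k * a) (gcd (k * b) (k * m))" using assms by simp
  also have "gcd (k * a) (gcd (k * b) (k * m)) = \<bar>k\<bar>"
    by (simp add: gcd_mult_left assms(1) del: gcd.assoc)
  finally show ?thesis by simp
qed

text \<open>Combines the frequencies found for the individual primes into one divisibility:
  \<open>m / gcd m x\<close> divides every such \<open>j\<close>, so it cannot have a prime
  factor.\<close>

lemma dvd_of_prime_cofactors:
  fixes m x :: int
  assumes "m > 0" "\<And>p. prime p \<Longrightarrow> int p dvd m \<Longrightarrow> \<exists>j. \<not> int p dvd j \<and> m dvd j * x"
  shows "m dvd x"
proof (rule ccontr)
  assume "\<not> m dvd x"
  define g where "g = gcd m x"
  have g: "g > 0" using assms(1) g_def by simp
  obtain m' where m': "m = g * m'" using g_def by (meson dvdE gcd_dvd1)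
  obtain x' where x': "x = g * x'" using g_def by (meson dvdE gcd_dvd2)
  have cop: "coprime m' x'"
  proof -
    have "g * gcd m' x' = g" using g_def m' x' g by (metis abs_of_pos gcd_mult_distrib_int)
    then show ?thesis using g by (simp add: coprime_iff_gcd_eq_1)
  qed
  have "m' > 0" using m' g assms(1) by (metis zero_less_mult_pos)
  moreover have "m' \<noteq> 1" using \<open>\<not> m dvd x\<close> m' x' by auto
  ultimately have "nat m' \<noteq> 1" by simp
  then obtain p where p: "prime p" "p dvd nat m'" using prime_factor_nat by blast
  then have pm': "int p dvd m'" using \<open>m' > 0\<close> by (simp add: int_dvd_int_iff[symmetric])
  then obtain j where j: "\<not> int p dvd j" "m dvd j * x" using assms(2)[OF p(1)] m' by auto
  then have "g * m' dvd g * (j * x')" by (simp add: m' x' mult.left_commute)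
  then have "m' dvd j" using g cop by (simp add: coprime_dvd_mult_left_iff)
  then show False using j(1) pm' dvd_trans by blast
qed

text \<open>Excludes order 4 for \<open>j * a\<close>. The gcd hypothesis gives
  \<open>2 * j = m * s\<close>, and the parity hypothesis makes \<open>s\<close> even, so
  \<open>m\<close> already divides \<open>j\<close>.\<close>

lemma no_quarter_frequency:
  fixes m a b j :: int
  assumes "gcd a (gcd b m) = 1" "even j" "2 * m dvd 2 * (j * b)" "2 * m dvd 4 * (j * a)"
    "odd b \<or> odd m"
  shows "2 * m dvd 2 * (j * a)"
proof -
  have "2 * m dvd 4 * j"
    using assms(1)
  proof (rule dvd_of_dvd_mult_gcd_eq_1)
    show "2 * m dvd 4 * j * a" using assms(4) by (simp add: mult.assoc)
    have "2 * m dvd 2 * (2 * (j * b))" using assms(3) by (rule dvd_mult)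
    then show "2 * m dvd 4 * j * b" by (simp add: mult.assoc)
    show "2 * m dvd 4 * j * m" by simp
  qed
  then obtain s where "4 * j = 2 * m * s" by blast
  then have s: "2 * j = m * s" by simp
  have "m dvd j"
  proof (cases "odd m")
    case True
    then have "even s" using s by (metis even_mult_iff dvd_triv_left)
    then show ?thesis using s by auto
  next
    case False
    then have b: "odd b" using assms(5) by blast
    show ?thesis
    proof (cases "m = 0")
      case True then show ?thesis using s by simp
    next
      case False
      obtain r where "2 * (j * b) = 2 * m * r" using assms(3) by blast
      then have "m * (s * b) = m * (2 * r)" using s by (metis mult.assoc mult.left_commute mult.commute)
      then have "s * b = 2 * r" using False by simp
      then have "even s" using b by (metis even_mult_iff dvd_triv_left)
      then show ?thesis using s by auto
    qed
  qed
  then show ?thesis by (simp add: mult_dvd_mono)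
qed

text \<open>With order 4 excluded, only order 3 remains for even \<open>j\<close>. There the gcd
  hypothesis yields \<open>2 * m dvd 3 * j\<close>; if 3 divided \<open>a\<close> or
  \<open>b\<close>, then \<open>j * a\<close> or \<open>j * b\<close> would vanish modulo
  \<open>2 * m\<close>.\<close>

lemma magic_frequency_cases:
  fixes m a b j :: int
  assumes "gcd a (gcd b m) = 1" "odd a \<and> odd b \<or> odd m" "magic_frequency m a b j"
  obtains (odd_plus) t where "odd j" "odd t" "j * (a + b) = t * m"
    | (odd_minus) t where "odd j" "odd t" "j * (a - b) = t * m"
    | (third) "2 * m dvd 3 * j" "\<not> 3 dvd a" "\<not> 3 dvd b"
proof -
  have thirdI: thesis if "2 * m dvd 3 * (j * a)" "2 * m dvd 3 * (j * b)" "\<not> 2 * m dvd j * a" "\<not> 2 * m dvd j * b" "even j"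
  proof (rule third)
    show d: "2 * m dvd 3 * j"
      using assms(1)
    proof (rule dvd_of_dvd_mult_gcd_eq_1)
      show "2 * m dvd 3 * j * a" "2 * m dvd 3 * j * b" using that by (simp_all add: mult.assoc)
      show "2 * m dvd 3 * j * m" using that(5) by (simp add: mult_dvd_mono)
    qed
    show "\<not> 3 dvd a"
    proof
      assume "3 dvd a"
      then obtain a' where "a = 3 * a'" by blast
      then have "j * a = 3 * j * a'" by simp
      then show False using d that(3) by (metis dvd_mult2)
    qed
    show "\<not> 3 dvd b"
    proof
      assume "3 dvd b"
      then obtain b' where "b = 3 * b'" by blast
      then have "j * b = 3 * j * b'" by simp
      then show False using d that(4) by (metis dvd_mult2)
    qed
  qed
  have gcd': "gcd b (gcd a m) = 1" using assms(1) by (metis gcd.left_commute)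
  show thesis
    using assms(3) unfolding magic_frequency_def
  proof (elim disjE conjE exE)
    fix t assume "odd j" "odd t" "j * (a + b) = t * m"
    then show thesis by (rule odd_plus)
  next
    fix t assume "odd j" "odd t" "j * (a - b) = t * m"
    then show thesis by (rule odd_minus)
  next
    assume "2 * m dvd 3 * (j * a)" "2 * m dvd 3 * (j * b)" "\<not> 2 * m dvd j * a" "\<not> 2 * m dvd j * b" "even j"
    then show thesis by (rule thirdI)
  next
    assume "even j" "2 * m dvd 2 * (j * b)" "2 * m dvd 4 * (j * a)" "\<not> 2 * m dvd 2 * (j * a)"
    then show thesis using no_quarter_frequency[OF assms(1)] assms(2) by metis
  next
    assume "even j" "2 * m dvd 2 * (j * a)" "2 * m dvd 4 * (j * b)" "\<not> 2 * m dvd 2 * (j * b)"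
    then show thesis using no_quarter_frequency[OF gcd'] assms(2) by metis
  qed
qed

text \<open>The goal of the necessity proof without graphs: a multiplier carrying the connection set
  to a set of the required form.\<close>

definition normalizes_to_condition :: "int \<Rightarrow> int \<Rightarrow> int \<Rightarrow> bool" where
  "normalizes_to_condition m a b \<longleftrightarrow>
    (\<exists>u c. coprime u (2 * m) \<and> 1 < c \<and> c < m \<and> circulant_condition (2 * m) c \<and>
      (\<lambda>x. (u * x) mod (2 * m)) ` {a, - a, b, - b, m} = (\<lambda>x. x mod (2 * m)) ` {1, - 1, c, - c, m})"

text \<open>This case leads to alternative (ii): up to sign \<open>c\<close> is the quotient of
  \<open>b\<close> by \<open>a\<close>, so its square is 1 modulo \<open>m\<close>.\<close>

lemma normalizes_to_condition_odd:
  fixes m a b :: int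
  assumes "m > 0" "odd m" "odd a" "even b" "coprime a m" "m dvd a\<^sup>2 - b\<^sup>2"
    "\<not> m dvd b" "\<not> 2 * m dvd a - b" "\<not> 2 * m dvd a + b"
  shows "normalizes_to_condition m a b"
proof -
  have "coprime a (2 * m)" using assms(3,5) by simp
  from normalize_unit[OF assms(1) this assms(7-9)]
  obtain u c where uc: "coprime u (2 * m)" "[u * a = 1] (mod 2 * m)" "1 < c" "c < m"
    "[c = u * b] (mod 2 * m) \<or> [c = - (u * b)] (mod 2 * m)"
    "(\<lambda>x. (u * x) mod (2 * m)) ` {a, - a, b, - b, m} = (\<lambda>x. x mod (2 * m)) ` {1, - 1, c, - c, m}"
    by blast
  have "even c"
  proof -
    have "[c = u * b] (mod 2) \<or> [c = - (u * b)] (mod 2)"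
      using uc(5) cong_dvd_modulus[of _ _ "2 * m" 2] by auto
    then show ?thesis using assms(4) by (auto simp: cong_dvd_iff)
  qed
  moreover have "[c\<^sup>2 = 1] (mod m)"
  proof -
    have "[c\<^sup>2 = (u * b)\<^sup>2] (mod 2 * m)"
      using uc(5) cong_pow[of c _ "2 * m" 2] by (metis power2_minus)
    then have 1: "[c\<^sup>2 = (u * b)\<^sup>2] (mod m)" by (rule cong_dvd_modulus) simp
    have "(u * b)\<^sup>2 - (u * a)\<^sup>2 = - (u\<^sup>2) * (a\<^sup>2 - b\<^sup>2)" by (simp add: power_mult_distrib algebra_simps)
    then have 2: "[(u * b)\<^sup>2 = (u * a)\<^sup>2] (mod m)" unfolding cong_iff_dvd_diff using assms(6) by simp
    have "[(u * a)\<^sup>2 = 1\<^sup>2] (mod m)"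
      using cong_pow[OF cong_dvd_modulus[OF uc(2) dvd_triv_right]] .
    with 1 2 show ?thesis using cong_trans by (metis power_one)
  qed
  then obtain s where s: "c\<^sup>2 - 1 = m * s" unfolding cong_iff_dvd_diff by blast
  \<comment> \<open>This makes the cofactor \<open>s\<close> odd, so that
    \<open>2 * (c\<^sup>2 - 1)\<close> is an odd multiple of \<open>2 * m\<close>.\<close>
  moreover have "odd (c\<^sup>2 - 1)" using \<open>even c\<close> by simp
  ultimately have "odd s" by simp
  moreover have "2 * (c\<^sup>2 - 1) = s * (2 * m)" using s by simp
  moreover have "[2 * m = 2] (mod 4)"
  proof -
    obtain x where "m = 2 * x + 1" using assms(2) by (elim oddE)
    then have "2 * m - 2 = 4 * x" by simp
    then show ?thesis unfolding cong_iff_dvd_diff by simp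
  qed
  ultimately have "circulant_condition (2 * m) c"
    using \<open>even c\<close> unfolding circulant_condition_def by blast
  with uc show ?thesis unfolding normalizes_to_condition_def by blast
qed

text \<open>All frequencies together give \<open>3 * (a + b) = m * w\<close> with \<open>w\<close>
  odd. If 3 divides \<open>w\<close>, then \<open>a + b\<close> is an odd multiple of
  \<open>m\<close> and (i) results; otherwise \<open>m = 3 * q\<close>, and (iii) or (iv)
  results.\<close>

lemma normalizes_to_condition_even:
  fixes m a b :: int
  assumes "m > 0" "even m" "gcd a (gcd b m) = 1" "odd j\<^sub>0" "odd t\<^sub>0" "j\<^sub>0 * (a + b) = t\<^sub>0 * m"
    and freq: "\<And>p. prime p \<Longrightarrow> int p dvd 2 * m \<Longrightarrow> \<exists>j. \<not> int p dvd j \<and> magic_frequency m a b j"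
    and "\<not> m dvd b" "\<not> 2 * m dvd a - b" "\<not> 2 * m dvd a + b"
  shows "normalizes_to_condition m a b"
proof -
  have "even (a + b)" using assms(2,4,6) by (metis even_mult_iff)
  moreover have "\<not> (even a \<and> even b)"
  proof
    assume "even a \<and> even b"
    then have "2 dvd gcd a (gcd b m)" using assms(2) by simp
    then show False using assms(3) by simp
  qed
  ultimately have ab: "odd a" "odd b" by auto
  \<comment> \<open>Otherwise \<open>(a + b) / 2\<close> and \<open>(a - b) / 2\<close> would both
    have the parity of \<open>m / 2\<close>, but they differ by the odd number
    \<open>b\<close>.\<close>
  have no_minus: False if "odd j" "odd t" "j * (a - b) = t * m" for j t
  proof -
    obtain x y z where xyz: "a = 2 * x + 1" "b = 2 * y + 1" "m = 2 * z"
      using ab assms(2) by (meson evenE oddE)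
    have "2 * (j\<^sub>0 * (x + y + 1)) = 2 * (t\<^sub>0 * z)" using assms(6) xyz by (simp add: algebra_simps)
    then have "j\<^sub>0 * (x + y + 1) = t\<^sub>0 * z" by simp
    then have "even (x + y + 1) \<longleftrightarrow> even z" using assms(4,5) by (metis even_mult_iff)
    moreover have "2 * (j * (x - y)) = 2 * (t * z)" using that xyz by (simp add: algebra_simps)
    then have "j * (x - y) = t * z" by simp
    then have "even (x - y) \<longleftrightarrow> even z" using that by (metis even_mult_iff)
    ultimately show False by auto
  qed
  have freq': "(m dvd j * (a + b)) \<or> (2 * m dvd 3 * j \<and> \<not> 3 dvd a \<and> \<not> 3 dvd b)"
    if "magic_frequency m a b j" for j
    using magic_frequency_cases[OF assms(3) _ that] ab no_minus by (metis dvd_triv_right)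
  have "m dvd 3 * (a + b)"
    using assms(1)
  proof (rule dvd_of_prime_cofactors)
    fix p :: nat assume p: "prime p" "int p dvd m"
    then obtain j where j: "\<not> int p dvd j" "magic_frequency m a b j" using freq by (metis dvd_mult)
    from freq'[OF j(2)] have "m dvd j * (3 * (a + b))"
    proof
      assume "m dvd j * (a + b)"
      then have "m dvd 3 * (j * (a + b))" by (rule dvd_mult)
      then show ?thesis by (simp add: mult.left_commute)
    next
      assume "2 * m dvd 3 * j \<and> \<not> 3 dvd a \<and> \<not> 3 dvd b"
      then have "m dvd 3 * j" by (metis dvd_mult_right)
      then have "m dvd 3 * j * (a + b)" by (rule dvd_mult2)
      then show ?thesis by (simp add: algebra_simps)
    qed
    with j(1) show "\<exists>j. \<not> int p dvd j \<and> m dvd j * (3 * (a + b))" by blast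
  qed
  then obtain w where w: "3 * (a + b) = m * w" by blast
  have "odd w"
  proof -
    \<comment> \<open>Comparison with the given odd frequency determines the parity of
      \<open>w\<close>.\<close>
    have "m * (j\<^sub>0 * w) = m * (3 * t\<^sub>0)" using w assms(6) by (metis mult.assoc mult.left_commute mult.commute)
    then have "j\<^sub>0 * w = 3 * t\<^sub>0" using assms(1) by simp
    then show ?thesis using assms(5) by (metis even_mult_iff odd_numeral)
  qed
  \<comment> \<open>A common prime of \<open>a\<close> and \<open>m\<close> that divides
    \<open>a + b\<close> also divides \<open>b\<close>, against the gcd hypothesis.\<close>
  have coprime_a: "coprime a (2 * m)" if "\<And>p::int. prime p \<Longrightarrow> p dvd a \<Longrightarrow> p dvd m \<Longrightarrow> p dvd a + b"
  proof -
    have "coprime a m"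
    proof (rule ccontr)
      assume "\<not> coprime a m"
      then obtain p :: int where p: "prime p" "p dvd gcd a m"
        using assms(1) by (metis coprime_iff_gcd_eq_1 is_unit_gcd gcd_eq_0_iff less_irrefl prime_divisor_exists)
      then have "p dvd b" using that[of p] by (simp add: dvd_add_right_iff)
      then have "p dvd gcd a (gcd b m)" using p by simp
      then show False using assms(3) p(1) by (simp add: not_prime_unit)
    qed
    then show ?thesis using ab by simp
  qed
  show ?thesis
  proof (cases "3 dvd w")
    case True
    then obtain t where t: "w = 3 * t" by blast
    then have "3 * (a + b) = 3 * (t * m)" using w by (simp only: mult_ac)
    then have abt: "a + b = t * m" by (metis mult_left_cancel zero_neq_numeral)
    have "odd t" using t \<open>odd w\<close> by simp
    have "coprime a (2 * m)" using coprime_a abt by simp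
    from normalize_unit[OF assms(1) this assms(8-10)]
    obtain u c where uc: "coprime u (2 * m)" "[u * a = 1] (mod 2 * m)" "1 < c" "c < m"
      "[c = u * b] (mod 2 * m) \<or> [c = - (u * b)] (mod 2 * m)"
      "(\<lambda>x. (u * x) mod (2 * m)) ` {a, - a, b, - b, m} = (\<lambda>x. x mod (2 * m)) ` {1, - 1, c, - c, m}"
      by blast
    have "odd (u * t)" using uc(1) \<open>odd t\<close> by (auto dest: coprime_common_divisor)
    then obtain v where v: "u * t = 2 * v + 1" by (elim oddE)
    obtain v' where v': "u * a = 1 + 2 * m * v'"
      using uc(2) by (metis cong_iff_lin cong_sym)
    have "u * b = u * (a + b) - u * a" by (simp add: distrib_left)
    also have "\<dots> = (u * t) * m - u * a" unfolding abt by simp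
    also have "\<dots> = (m - 1) + 2 * m * (v - v')" unfolding v v' by (simp add: algebra_simps)
    finally have ub: "u * b = (m - 1) + 2 * m * (v - v')" .
    have "c = m - 1"
      using uc(5)
    proof
      assume "[c = u * b] (mod 2 * m)"
      then have "c mod (2 * m) = (m - 1) mod (2 * m)" unfolding cong_def ub by simp
      then show ?thesis using uc(3,4) by simp
    next
      assume "[c = - (u * b)] (mod 2 * m)"
      moreover have "- (u * b) = (m + 1) + 2 * m * (v' - v - 1)" using ub by (simp add: algebra_simps)
      ultimately have "c mod (2 * m) = (m + 1) mod (2 * m)" unfolding cong_def by simp
      \<comment> \<open>The hypothesis is contradictory here, since \<open>1 < c < m\<close> makes
        both sides reduced and distinct.\<close>
      then show ?thesis using uc(3,4) by simp
    qed
    then have "circulant_condition (2 * m) c" unfolding circulant_condition_def by simp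
    with uc show ?thesis unfolding normalizes_to_condition_def by blast
  next
    case False
    have "3 dvd m * w" using w by (metis dvd_triv_left)
    then have "3 dvd m" using False prime_dvd_mult_iff[of "3::int" m w] by simp
    then obtain q where q: "m = 3 * q" by blast
    then have "3 * (a + b) = 3 * (q * w)" using w by (simp only: mult_ac)
    then have abq: "a + b = q * w" by (metis mult_left_cancel zero_neq_numeral)
    have "q > 0" "even q" using q assms(1,2) by auto
    \<comment> \<open>The frequency belonging to the prime 3 must be of the order-three kind; hence
      3 divides none of \<open>q\<close>, \<open>a\<close>, \<open>b\<close>.\<close>
    obtain j where j: "\<not> 3 dvd j" "magic_frequency m a b j"
      using freq[of 3] \<open>3 dvd m\<close> by auto
    have "\<not> m dvd j * (a + b)"
    proof
      assume "m dvd j * (a + b)"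
      then have "q * 3 dvd q * (j * w)" by (simp add: q abq mult_ac)
      then have "3 dvd j * w" using \<open>q > 0\<close> by simp
      then show False using j(1) False prime_dvd_mult_iff[of "3::int" j w] by simp
    qed
    then have jab: "2 * m dvd 3 * j" "\<not> 3 dvd a" "\<not> 3 dvd b" using freq'[OF j(2)] by auto
    then have "3 * (2 * q) dvd 3 * j" by (simp add: q)
    then have "2 * q dvd j" by (metis dvd_times_left_cancel_iff zero_neq_numeral)
    then have "\<not> 3 dvd q" using j(1) by (meson dvd_mult_right dvd_trans dvd_triv_right)
    then have "\<not> 3 dvd a + b" using False prime_dvd_mult_iff[of "3::int" q w] abq by simp
    then have ab3: "a mod 3 = b mod 3" using jab(2,3) by presburger
    have "coprime a (2 * m)"
    proof (rule coprime_a)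
      fix p :: int assume p: "prime p" "p dvd a" "p dvd m"
      show "p dvd a + b"
      proof (cases "p dvd q")
        case False
        then have "p dvd 3" using p q prime_dvd_mult_iff by blast
        then have "p = 3" using primes_dvd_imp_eq[OF p(1), of 3] by simp
        then show ?thesis using p jab by simp
      qed (simp add: abq)
    qed
    from normalize_unit[OF assms(1) this assms(8-10)]
    obtain u c where uc: "coprime u (2 * m)" "[u * a = 1] (mod 2 * m)" "1 < c" "c < m"
      "[c = u * b] (mod 2 * m) \<or> [c = - (u * b)] (mod 2 * m)"
      "(\<lambda>x. (u * x) mod (2 * m)) ` {a, - a, b, - b, m} = (\<lambda>x. x mod (2 * m)) ` {1, - 1, c, - c, m}"
      by blast
    have "odd u" using uc(1) by (auto dest: coprime_common_divisor)
    have "\<not> 3 dvd u"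
    proof
      assume "3 dvd u"
      moreover have "3 dvd 2 * m" using q by simp
      ultimately show False using uc(1) coprime_common_divisor[of u "2 * m" 3] by simp
    qed
    then have "\<not> 3 dvd u * w" using False prime_dvd_mult_iff[of "3::int" u w] by simp
    moreover have "odd (u * w)" using \<open>odd u\<close> \<open>odd w\<close> by simp
    ultimately obtain e v where e: "e = 1 \<or> e = - 1" "u * w = e + 6 * v"
      using coprime_six_decomp by blast
    obtain v' where v': "u * a = 1 + 2 * m * v'"
      using uc(2) by (metis cong_iff_lin cong_sym)
    have "u * b = u * (a + b) - u * a" by (simp add: distrib_left)
    also have "\<dots> = (u * w) * q - u * a" unfolding abq by simp
    also have "\<dots> = (e * q - 1) + 6 * q * (v - v')" unfolding e(2) v' by (simp add: q algebra_simps)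
    finally have ub: "u * b = (e * q - 1) + 6 * q * (v - v')" .
    \<comment> \<open>The residue of \<open>u * b\<close> modulo 3 is computed twice: it is 1
      because \<open>a\<close> and \<open>b\<close> agree modulo 3, and it is
      \<open>e * q - 1\<close>. This determines \<open>q\<close> modulo 3.\<close>
    have "u * a = 1 + 3 * (2 * q * v')" using v' q by simp
    then have "u * a mod 3 = 1 mod 3" by (simp only: mod_mult_self2)
    moreover have "u * b mod 3 = u * a mod 3" using ab3 by (metis mod_mult_right_eq)
    ultimately have "u * b mod 3 = 1" by simp
    moreover have "u * b = (e * q - 1) + 3 * (2 * q * (v - v'))" using ub by simp
    then have "u * b mod 3 = (e * q - 1) mod 3" by (simp only: mod_mult_self2)
    ultimately have "(e * q - 1) mod 3 = 1" by simp
    then have "q mod 3 = (- e) mod 3" using e(1) by (elim disjE; simp; presburger)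
    moreover have "c = q - e"
    proof -
      have "[c = e * q - 1] (mod 6 * q) \<or> [c = 1 - e * q] (mod 6 * q)"
        using uc(5)
      proof
        assume "[c = u * b] (mod 2 * m)"
        then show ?thesis unfolding cong_def ub q by simp
      next
        assume "[c = - (u * b)] (mod 2 * m)"
        moreover have "- (u * b) = (1 - e * q) + 6 * q * (v' - v)" using ub by (simp add: algebra_simps)
        ultimately show ?thesis unfolding cong_def q by simp
      qed
      then obtain s where s: "c - (e * q - 1) = 6 * q * s \<or> c - (1 - e * q) = 6 * q * s"
        unfolding cong_iff_dvd_diff by blast
      have bnd: "1 < c" "c < 3 * q" "q \<ge> 2" using uc(3,4) q \<open>q > 0\<close> \<open>even q\<close> by auto
      from bounded_residue[OF e(1) s bnd] show ?thesis .
    qed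
    ultimately have "circulant_condition (6 * q) c"
      using circulant_condition_six[of q e c] \<open>q > 0\<close> \<open>even q\<close> e(1) uc(3) by simp
    then have "circulant_condition (2 * m) c" using q by simp
    with uc show ?thesis unfolding normalizes_to_condition_def by blast
  qed
qed

section \<open>Symmetry in the two generators, and the case split on the parity of
  \<open>m\<close>\<close>

lemma normalizes_to_condition_swap: "normalizes_to_condition m a b \<Longrightarrow> normalizes_to_condition m b a"
proof -
  have "{a, - a, b, - b, m} = {b, - b, a, - a, m}" by auto
  then show "normalizes_to_condition m a b \<Longrightarrow> normalizes_to_condition m b a"
    unfolding normalizes_to_condition_def by (simp only:)
qed

lemma magic_frequency_minus: "magic_frequency m a (- b) j \<longleftrightarrow> magic_frequency m a b j"
proof -
  have "(\<exists>t. odd t \<and> (j * (a + - b) = t * m \<or> j * (a - - b) = t * m)) \<longleftrightarrow>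
      (\<exists>t. odd t \<and> (j * (a + b) = t * m \<or> j * (a - b) = t * m))"
    by (simp only: add_uminus_conv_diff diff_minus_eq_add) blast
  then show ?thesis unfolding magic_frequency_def by (simp only: mult_minus_right dvd_minus_iff)
qed

lemma normalizes_to_condition_minus: "normalizes_to_condition m a (- b) \<Longrightarrow> normalizes_to_condition m a b"
proof -
  have "{a, - a, - b, - (- b), m} = {a, - a, b, - b, m}" by auto
  then show "normalizes_to_condition m a (- b) \<Longrightarrow> normalizes_to_condition m a b"
    unfolding normalizes_to_condition_def by (simp only:)
qed

lemma normalizes_to_condition_of_frequencies:
  fixes m a b :: int
  assumes "m > 0" "gcd a (gcd b m) = 1"
    and freq: "\<And>p. prime p \<Longrightarrow> int p dvd 2 * m \<Longrightarrow> \<exists>j. \<not> int p dvd j \<and> magic_frequency m a b j"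
    and nd: "\<not> m dvd a" "\<not> m dvd b" "\<not> 2 * m dvd a - b" "\<not> 2 * m dvd a + b"
  shows "normalizes_to_condition m a b"
proof -
  \<comment> \<open>The frequency belonging to the prime 2 is odd; it decides between
    \<open>a + b\<close> and \<open>a - b\<close>.\<close>
  obtain j\<^sub>0 where j0: "odd j\<^sub>0" "magic_frequency m a b j\<^sub>0"
    using freq[of 2] by auto
  then obtain t\<^sub>0 where t0: "odd t\<^sub>0" "j\<^sub>0 * (a + b) = t\<^sub>0 * m \<or> j\<^sub>0 * (a - b) = t\<^sub>0 * m"
    unfolding magic_frequency_def by blast
  show ?thesis
  proof (cases "even m")
    case True
    from t0(2) show ?thesis
    proof
      assume "j\<^sub>0 * (a + b) = t\<^sub>0 * m"
      with True assms j0 t0(1) show ?thesis by (intro normalizes_to_condition_even) auto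
    next
      assume "j\<^sub>0 * (a - b) = t\<^sub>0 * m"
      with True assms j0 t0(1) have "normalizes_to_condition m a (- b)"
        by (intro normalizes_to_condition_even) (auto simp: magic_frequency_minus)
      then show ?thesis by (rule normalizes_to_condition_minus)
    qed
  next
    case False
    \<comment> \<open>For odd \<open>m\<close> every frequency satisfies
      \<open>m dvd j * (a\<^sup>2 - b\<^sup>2)\<close>: an odd one through a factor of the
      difference of squares, one of order 3 because neither \<open>a\<close> nor \<open>b\<close> is
      divisible by 3.\<close>
    have dvd: "m dvd a\<^sup>2 - b\<^sup>2"
      using assms(1)
    proof (rule dvd_of_prime_cofactors)
      fix p :: nat assume p: "prime p" "int p dvd m"
      then obtain j where j: "\<not> int p dvd j" "magic_frequency m a b j" using freq by (metis dvd_mult)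
      have sq: "j * (a\<^sup>2 - b\<^sup>2) = j * (a + b) * (a - b)" "j * (a\<^sup>2 - b\<^sup>2) = j * (a - b) * (a + b)"
        by (simp_all add: power2_eq_square algebra_simps)
      have "odd a \<and> odd b \<or> odd m" using False by blast
      from assms(2) this j(2) have "m dvd j * (a\<^sup>2 - b\<^sup>2)"
      proof (cases rule: magic_frequency_cases)
        case (odd_plus t)
        then show ?thesis unfolding sq(1) by simp
      next
        case (odd_minus t)
        then show ?thesis unfolding sq(2) by simp
      next
        case third
        have "3 dvd a + b \<or> 3 dvd a - b" using third(2,3) by presburger
        then have "3 dvd (a + b) * (a - b)" by auto
        then obtain x where "a\<^sup>2 - b\<^sup>2 = 3 * x" by (auto simp: power2_eq_square algebra_simps)
        then have "j * (a\<^sup>2 - b\<^sup>2) = 3 * j * x" by simp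
        moreover have "m dvd 3 * j" using third(1) by (metis dvd_mult_right)
        ultimately show ?thesis by (simp only: dvd_mult2)
      qed
      with j(1) show "\<exists>j. \<not> int p dvd j \<and> m dvd j * (a\<^sup>2 - b\<^sup>2)" by blast
    qed
    have common: "p dvd b \<longleftrightarrow> p dvd a" if "prime p" "p dvd m" for p
    proof -
      have "p dvd a\<^sup>2 - b\<^sup>2" using dvd that dvd_trans by blast
      then have "p dvd a\<^sup>2 \<longleftrightarrow> p dvd b\<^sup>2" using dvd_diff_right_iff dvd_diff_left_iff by blast
      then show ?thesis using that(1) by (simp add: prime_dvd_power_iff)
    qed
    have cop: "coprime x m" if "x = a \<or> x = b" for x
    proof (rule ccontr)
      assume "\<not> coprime x m"
      then obtain p where p: "prime p" "p dvd gcd x m"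
        using assms(1) by (metis coprime_iff_gcd_eq_1 is_unit_gcd gcd_eq_0_iff less_irrefl prime_divisor_exists)
      then have "p dvd gcd a (gcd b m)" using that common[of p] by auto
      then show False using assms(2) p(1) by (simp add: not_prime_unit)
    qed
    \<comment> \<open>Exactly one of \<open>a\<close> and \<open>b\<close> is odd, and that one is a
      unit modulo \<open>2 * m\<close>.\<close>
    have "odd (a + b)"
    proof -
      have "odd (t\<^sub>0 * m)" using False t0(1) by simp
      then have "odd (a + b) \<or> odd (a - b)" using t0(2) by (metis even_mult_iff)
      then show ?thesis by simp
    qed
    then consider "odd a" "even b" | "even a" "odd b" by auto
    then show ?thesis
    proof cases
      case 1
      then show ?thesis
        using assms False cop dvd by (intro normalizes_to_condition_odd) auto
    next
      case 2
      have "m dvd b\<^sup>2 - a\<^sup>2" "\<not> 2 * m dvd b - a" "\<not> 2 * m dvd b + a"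
        using dvd nd by (simp_all add: dvd_diff_commute add.commute)
      then have "normalizes_to_condition m b a"
        using assms False cop 2 by (intro normalizes_to_condition_odd) auto
      then show ?thesis by (rule normalizes_to_condition_swap)
    qed
  qed
qed

section \<open>Cayley graphs of cyclic groups\<close>

text \<open>The group is presented as a quotient of the integers, so that arithmetic takes place in
  \<open>int\<close>. The abstract cyclic group and \<open>integer_mod_group\<close> are both
  instances.\<close>

locale cyclic_parametrization =
  fixes G :: "('a, 'm) monoid_scheme" and e :: "int \<Rightarrow> 'a" and n :: nat
  assumes n_pos: "n > 0"
    and carrier_eq: "carrier G = range e"
    and e_eq_iff: "e x = e y \<longleftrightarrow> int n dvd x - y"
    and e_add: "e x \<otimes>\<^bsub>G\<^esub> e y = e (x + y)"
begin

lemma e_mod [simp]: "e (x mod int n) = e x"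
  by (simp add: e_eq_iff mod_eq_dvd_iff[symmetric])

lemma inj_on_e: "inj_on e {0..<int n}"
proof (rule inj_onI)
  fix x y assume *: "x \<in> {0..<int n}" "y \<in> {0..<int n}" "e x = e y"
  then have "x mod int n = y mod int n" by (simp only: e_eq_iff mod_eq_dvd_iff)
  with * show "x = y" by simp
qed

lemma carrier_eq_image: "carrier G = e ` {0..<int n}"
proof -
  have "e x \<in> e ` {0..<int n}" for x
    using n_pos by (intro image_eqI[of _ _ "x mod int n"]) auto
  then show ?thesis unfolding carrier_eq by auto
qed

lemma card_carrier: "card (carrier G) = n"
  unfolding carrier_eq_image by (simp add: card_image inj_on_e)

lemma pverts_cayley [simp]: "pverts (cayley_graph G S) = range e"
  by (simp add: cayley_graph_def carrier_eq)

lemma parcs_cayley: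
  assumes "S \<subseteq> range e"
  shows "(e x, e y) \<in> parcs (cayley_graph G S) \<longleftrightarrow> e (y - x) \<in> S"
proof
  assume "(e x, e y) \<in> parcs (cayley_graph G S)"
  then obtain z where z: "e z \<in> S" "e y = e x \<otimes>\<^bsub>G\<^esub> e z"
    using assms by (auto simp: cayley_graph_def)
  then have "e y = e (x + z)" by (simp add: e_add)
  then have "e (y - x) = e z" by (simp add: e_eq_iff algebra_simps)
  with z(1) show "e (y - x) \<in> S" by simp
next
  assume "e (y - x) \<in> S"
  moreover have "e y = e x \<otimes>\<^bsub>G\<^esub> e (y - x)" by (simp add: e_add)
  ultimately have "\<exists>s\<in>S. e y = e x \<otimes>\<^bsub>G\<^esub> s" by blast
  then show "(e x, e y) \<in> parcs (cayley_graph G S)"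
    by (simp add: cayley_graph_def carrier_eq)
qed

lemma parcs_cayley_subset: "parcs (cayley_graph G S) \<subseteq> range e \<times> range e"
  by (auto simp: cayley_graph_def carrier_eq)

lemma closed_neighborhood_cayley:
  "closed_neighborhood (cayley_graph G (e ` D)) (e x) = (\<lambda>d. e (x + d)) ` insert 0 D"
proof -
  have "v \<in> (\<lambda>d. e (x + d)) ` D" if v: "v \<in> range e" "(e x, v) \<in> parcs (cayley_graph G (e ` D))" for v
  proof -
    obtain y where y: "v = e y" using v by blast
    then obtain d where "d \<in> D" "e (y - x) = e d"
      using v parcs_cayley[of "e ` D" x y] by auto
    then have "v = e (x + d)" by (simp add: y e_eq_iff algebra_simps)
    with \<open>d \<in> D\<close> show ?thesis by blast
  qed
  moreover have "(e x, e (x + d)) \<in> parcs (cayley_graph G (e ` D))" if "d \<in> D" for d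
    using that by (subst parcs_cayley) auto
  ultimately show ?thesis unfolding closed_neighborhood_def by auto
qed

text \<open>The hypotheses make the six offsets distinct modulo \<open>2 * m\<close>, so the sum
  over the set has six separate terms.\<close>

lemma sum_closed_neighborhood:
  fixes l :: "'a \<Rightarrow> nat"
  assumes n: "int n = 2 * m"
    and nd: "\<not> m dvd a" "\<not> m dvd b" "\<not> 2 * m dvd a - b" "\<not> 2 * m dvd a + b"
  shows "(\<Sum>v\<in>closed_neighborhood (cayley_graph G (e ` {a, - a, b, - b, m})) (e x). l v) =
    l (e x) + l (e (x + m)) + l (e (x + a)) + l (e (x - a)) + l (e (x + b)) + l (e (x - b))"
proof -
  have m: "m > 0" using n n_pos by simp
  have half: "m dvd y" if "2 * m dvd 2 * y" for y using that by simp
  have shift: "m dvd y" if "2 * m dvd y - m \<or> 2 * m dvd y + m \<or> 2 * m dvd m - y \<or> 2 * m dvd m + y" for y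
  proof -
    have "m dvd y - m \<or> m dvd y + m \<or> m dvd m - y \<or> m dvd m + y"
      using that by (meson dvd_mult_right)
    then show ?thesis by (simp add: dvd_add_right_iff dvd_add_left_iff dvd_diff_right_iff dvd_diff_left_iff)
  qed
  have multiple: "m dvd y" if "2 * m dvd y \<or> 2 * m dvd - y" for y
    using that by (metis dvd_minus_iff dvd_mult_right)
  have sym: "2 * m dvd b - a \<longleftrightarrow> 2 * m dvd a - b" "2 * m dvd - a - b \<longleftrightarrow> 2 * m dvd a + b"
    "2 * m dvd - a + b \<longleftrightarrow> 2 * m dvd a - b" "2 * m dvd b + a \<longleftrightarrow> 2 * m dvd a + b"
    using dvd_minus_iff[of "2 * m" "a - b"] dvd_minus_iff[of "2 * m" "a + b"] by (simp_all add: algebra_simps)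
  have nm: "\<not> 2 * m dvd m" using m zdvd_imp_le[of "2 * m" m] by auto
  define h where "h d = e (x + d)" for d
  have h: "h d = h d' \<longleftrightarrow> 2 * m dvd d - d'" for d d'
    unfolding h_def e_eq_iff n by simp
  have distinct: "h 0 \<noteq> h a" "h 0 \<noteq> h (- a)" "h 0 \<noteq> h b" "h 0 \<noteq> h (- b)" "h 0 \<noteq> h m"
    "h a \<noteq> h (- a)" "h a \<noteq> h b" "h a \<noteq> h (- b)" "h a \<noteq> h m" "h (- a) \<noteq> h b" "h (- a) \<noteq> h (- b)"
    "h (- a) \<noteq> h m" "h b \<noteq> h (- b)" "h b \<noteq> h m" "h (- b) \<noteq> h m"
    unfolding h
    using nd nm multiple[of a] multiple[of b] half[of a] half[of b] shift[of a] shift[of "- a"]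
      shift[of b] shift[of "- b"] sym dvd_minus_iff[of "2 * m" m] dvd_minus_iff[of "2 * m" "a + b"]
    by (auto simp: algebra_simps)
  have "(\<Sum>v\<in>closed_neighborhood (cayley_graph G (e ` {a, - a, b, - b, m})) (e x). l v) =
      (\<Sum>v\<in>{h 0, h a, h (- a), h b, h (- b), h m}. l v)"
    unfolding closed_neighborhood_cayley h_def by simp
  also have "\<dots> = l (h 0) + l (h a) + l (h (- a)) + l (h b) + l (h (- b)) + l (h m)"
    using distinct by simp
  finally show ?thesis by (simp add: h_def)
qed

lemma closed_distance_magic_labeling_cayley:
  assumes n: "int n = 2 * m"
    and nd: "\<not> m dvd a" "\<not> m dvd b" "\<not> 2 * m dvd a - b" "\<not> 2 * m dvd a + b"
  shows "closed_distance_magic_labeling (cayley_graph G (e ` {a, - a, b, - b, m})) l \<longleftrightarrow>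
    bij_betw l (range e) {1..n} \<and> (\<exists>r>0. \<forall>x.
      l (e x) + l (e (x + m)) + l (e (x + a)) + l (e (x - a)) + l (e (x + b)) + l (e (x - b)) = r)"
proof -
  have card: "card (range e) = n" using card_carrier by (simp only: carrier_eq)
  have "(\<forall>u\<in>range e. (\<Sum>v\<in>closed_neighborhood (cayley_graph G (e ` {a, - a, b, - b, m})) u. l v) = r) \<longleftrightarrow>
      (\<forall>x. l (e x) + l (e (x + m)) + l (e (x + a)) + l (e (x - a)) + l (e (x + b)) + l (e (x - b)) = r)" for r
    by (simp only: ball_simps(9) sum_closed_neighborhood[OF assms] ball_UNIV)
  then show ?thesis
    unfolding closed_distance_magic_labeling_def pverts_cayley card by (simp only:)
qed

text \<open>Divisibility by \<open>d\<close> is well defined on group elements because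
  \<open>d\<close> divides \<open>n\<close>, and it is preserved along arcs. A walk from
  \<open>e 0\<close> to \<open>e 1\<close> carries it to 1.\<close>

lemma connected_cayley_imp_coprime:
  assumes "Digraph_Component.connected (with_proj (cayley_graph G (e ` D)))"
    and "d dvd int n" "\<And>x. x \<in> D \<Longrightarrow> d dvd x"
  shows "is_unit d"
proof -
  let ?\<Gamma> = "cayley_graph G (e ` D)"
  have dvd_iff: "d dvd x \<longleftrightarrow> d dvd y" if "e x = e y" for x y
  proof -
    have "d dvd x - y" using that assms(2) dvd_trans unfolding e_eq_iff by blast
    then show ?thesis using dvd_diff_left_iff dvd_diff_right_iff by blast
  qed
  have arc: "d dvd y - x" if "(e x, e y) \<in> parcs ?\<Gamma>" for x y
  proof -
    have "e (y - x) \<in> e ` D" using that parcs_cayley[OF image_mono[OF subset_UNIV]] by simp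
    then obtain z where "z \<in> D" "e (y - x) = e z" by blast
    then show ?thesis using assms(3) dvd_iff by blast
  qed
  have "e 0 \<rightarrow>\<^sup>*\<^bsub>with_proj (mk_symmetric (with_proj ?\<Gamma>))\<^esub> e 1"
    using assms(1) unfolding connected_def strongly_connected_def by (auto simp: mk_symmetric_def)
  then have "(e 0, e 1) \<in> rtrancl_on (range e) (parcs (mk_symmetric (with_proj ?\<Gamma>)))"
    by (simp add: reachable_def mk_symmetric_def)
  then have "\<exists>x. e 1 = e x \<and> d dvd x"
  proof (induction rule: rtrancl_on_induct)
    case base
    show ?case by (intro exI[of _ 0]) simp
  next
    case (step y z)
    then obtain x x' where x: "y = e x" "d dvd x" "z = e x'" by blast
    with step.hyps(2) have "(e x, e x') \<in> parcs ?\<Gamma> \<or> (e x', e x) \<in> parcs ?\<Gamma>"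
      by (auto simp: mk_symmetric_def)
    then have "d dvd x' - x \<or> d dvd x - x'" using arc by blast
    then have "d dvd x'" using x(2) by (metis dvd_diff_left_iff dvd_diff_right_iff)
    with x(3) show ?case by blast
  qed
  then show ?thesis using dvd_iff by blast
qed

end

lemma (in group) cyclic_parametrization_exists:
  assumes "finite (carrier G)" "cyclic_group G"
  shows "\<exists>e. cyclic_parametrization G e (card (carrier G))"
proof -
  obtain g where g: "g \<in> carrier G" "carrier G = range (\<lambda>i::int. g [^] i)"
    using assms(2) cyclic_group by blast
  have ord: "ord g > 0" using ord_ge_1[OF assms(1) g(1)] by simp
  interpret e: cyclic_parametrization G "\<lambda>i::int. g [^] i" "ord g"
  proof
    show "0 < ord g" by fact
    show "carrier G = range (\<lambda>i::int. g [^] i)" by fact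
    show "(g [^] x = g [^] y) = (int (ord g) dvd x - y)" for x y :: int
      using int_pow_eq[OF g(1)] by (metis dvd_diff_commute)
    show "g [^] x \<otimes> g [^] y = g [^] (x + y)" for x y :: int
      using g(1) by (simp add: int_pow_mult)
  qed
  show ?thesis unfolding e.card_carrier using e.cyclic_parametrization_axioms by blast
qed

lemma cyclic_parametrization_integer_mod_group:
  "n > 0 \<Longrightarrow> cyclic_parametrization (integer_mod_group n) (\<lambda>x. x mod int n) n"
proof
  assume n: "n > 0"
  have "x \<in> range (\<lambda>x. x mod int n)" if "x \<in> {0..<int n}" for x
    using that by (intro image_eqI[of _ _ x]) auto
  then show "carrier (integer_mod_group n) = range (\<lambda>x. x mod int n)"
    using n by (auto simp: carrier_integer_mod_group)
qed (auto simp: mod_eq_dvd_iff mod_simps)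

text \<open>A digraph isomorphism also carries an arc map and new head and tail functions. Between
  pair digraphs the latter are the projections, so the vertex map determines the arc map.\<close>

lemma digraph_iso_with_projE:
  assumes "digraph_iso (with_proj \<Gamma>) (with_proj \<Delta>)"
  obtains \<phi> where "inj_on \<phi> (pverts \<Gamma>)" "pverts \<Delta> = \<phi> ` pverts \<Gamma>" "parcs \<Delta> = map_prod \<phi> \<phi> ` parcs \<Gamma>"
proof -
  obtain f where f: "pre_digraph.digraph_isomorphism (with_proj \<Gamma>) f" "with_proj \<Delta> = app_iso f (with_proj \<Gamma>)"
    using assms unfolding digraph_iso_def by blast
  have tail: "iso_tail f = fst" and head: "iso_head f = snd"
    and verts: "pverts \<Delta> = iso_verts f ` pverts \<Gamma>" and arcs: "parcs \<Delta> = iso_arcs f ` parcs \<Gamma>"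
    using f(2) by (simp_all add: with_proj_def app_iso_def)
  have "inj_on (iso_verts f) (pverts \<Gamma>)"
    and "\<And>a. a \<in> parcs \<Gamma> \<Longrightarrow> iso_arcs f a = map_prod (iso_verts f) (iso_verts f) a"
    using f(1) unfolding pre_digraph.digraph_isomorphism_def by (auto simp: tail head prod_eq_iff)
  then show ?thesis using that[of "iso_verts f"] verts arcs by (auto intro!: image_cong)
qed

lemma digraph_iso_with_projI:
  assumes "parcs \<Gamma> \<subseteq> pverts \<Gamma> \<times> pverts \<Gamma>" "inj_on \<phi> (pverts \<Gamma>)"
    "pverts \<Delta> = \<phi> ` pverts \<Gamma>" "parcs \<Delta> = map_prod \<phi> \<phi> ` parcs \<Gamma>"
  shows "digraph_iso (with_proj \<Gamma>) (with_proj \<Delta>)"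
proof -
  define f where "f = \<lparr> iso_verts = \<phi>, iso_arcs = map_prod \<phi> \<phi>, iso_head = snd, iso_tail = fst \<rparr>"
  have "inj_on (map_prod \<phi> \<phi>) (parcs \<Gamma>)"
    using map_prod_inj_on[OF assms(2,2)] assms(1) by (rule inj_on_subset)
  moreover have "wf_digraph (with_proj \<Gamma>)" using assms(1) by unfold_locales auto
  ultimately have "pre_digraph.digraph_isomorphism (with_proj \<Gamma>) f"
    unfolding pre_digraph.digraph_isomorphism_def using assms(2) by (simp add: f_def)
  moreover have "with_proj \<Delta> = app_iso f (with_proj \<Gamma>)"
    using assms(3,4) by (simp add: with_proj_def app_iso_def f_def)
  ultimately show ?thesis unfolding digraph_iso_def by blast
qed

lemma closed_distance_magic_iso:
  assumes "digraph_iso (with_proj \<Gamma>) (with_proj \<Delta>)" "parcs \<Gamma> \<subseteq> pverts \<Gamma> \<times> pverts \<Gamma>"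
    and "closed_distance_magic \<Delta>"
  shows "closed_distance_magic \<Gamma>"
proof -
  obtain \<phi> where \<phi>: "inj_on \<phi> (pverts \<Gamma>)" "pverts \<Delta> = \<phi> ` pverts \<Gamma>" "parcs \<Delta> = map_prod \<phi> \<phi> ` parcs \<Gamma>"
    using digraph_iso_with_projE[OF assms(1)] .
  obtain l r where l: "bij_betw l (pverts \<Delta>) {1..card (pverts \<Delta>)}" "r > 0"
    "\<And>u. u \<in> pverts \<Delta> \<Longrightarrow> (\<Sum>x\<in>closed_neighborhood \<Delta> u. l x) = r"
    using assms(3) unfolding closed_distance_magic_def closed_distance_magic_labeling_def by blast
  have card: "card (pverts \<Delta>) = card (pverts \<Gamma>)" using \<phi> by (simp add: card_image)
  have "(\<Sum>x\<in>closed_neighborhood \<Gamma> u. (l \<circ> \<phi>) x) = r" if u: "u \<in> pverts \<Gamma>" for u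
  proof -
    have arc: "(\<phi> u, \<phi> v) \<in> parcs \<Delta> \<longleftrightarrow> (u, v) \<in> parcs \<Gamma>" if "v \<in> pverts \<Gamma>" for v
    proof
      assume "(\<phi> u, \<phi> v) \<in> parcs \<Delta>"
      then obtain u' v' where "(u', v') \<in> parcs \<Gamma>" "\<phi> u' = \<phi> u" "\<phi> v' = \<phi> v"
        unfolding \<phi>(3) by auto
      moreover from this have "u' = u" "v' = v"
        using assms(2) u that inj_onD[OF \<phi>(1)] by blast+
      ultimately show "(u, v) \<in> parcs \<Gamma>" by simp
    qed (force simp: \<phi>(3))
    have "closed_neighborhood \<Delta> (\<phi> u) = \<phi> ` closed_neighborhood \<Gamma> u"
      unfolding closed_neighborhood_def \<phi>(2) using arc by auto
    moreover have "inj_on \<phi> (closed_neighborhood \<Gamma> u)"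
      using \<phi>(1) by (rule inj_on_subset) (use u in \<open>auto simp: closed_neighborhood_def\<close>)
    ultimately have "(\<Sum>x\<in>closed_neighborhood \<Gamma> u. (l \<circ> \<phi>) x) = (\<Sum>x\<in>closed_neighborhood \<Delta> (\<phi> u). l x)"
      by (simp add: sum.reindex)
    then show ?thesis using l(3) \<phi>(2) u by simp
  qed
  moreover have "bij_betw (l \<circ> \<phi>) (pverts \<Gamma>) {1..card (pverts \<Gamma>)}"
    using l(1) \<phi>(1,2) card by (metis bij_betw_imageI bij_betw_trans)
  ultimately show ?thesis
    using l(2) unfolding closed_distance_magic_def closed_distance_magic_labeling_def by blast
qed

text \<open>Multiplication by a unit respects differences, so it transports one Cayley graph to the
  other.\<close>

lemma cayley_iso_of_unit:
  assumes "cyclic_parametrization G e n" "cyclic_parametrization H e' n" "coprime u (int n)"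
    and D: "(\<lambda>x. (u * x) mod int n) ` D = (\<lambda>x. x mod int n) ` D'"
  shows "digraph_iso (with_proj (cayley_graph G (e ` D))) (with_proj (cayley_graph H (e' ` D')))"
proof -
  interpret e: cyclic_parametrization G e n by fact
  interpret e': cyclic_parametrization H e' n by fact
  \<comment> \<open>The chosen representative is irrelevant: a multiple of \<open>n\<close> remains
    one after multiplication by \<open>u\<close>.\<close>
  define \<phi> where "\<phi> v = e' (u * (SOME x. e x = v))" for v
  have \<phi>: "\<phi> (e x) = e' (u * x)" for x
  proof -
    have "e (SOME y. e y = e x) = e x" by (rule someI[of _ x]) simp
    then have "int n dvd u * ((SOME y. e y = e x) - x)" unfolding e.e_eq_iff by simp
    then show ?thesis unfolding \<phi>_def e'.e_eq_iff by (simp add: right_diff_distrib)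
  qed
  have surj: "\<exists>x. e' y = e' (u * x)" for y
  proof -
    obtain v where "[u * v = 1] (mod int n)" using cong_solve_coprime_int[OF assms(3)] by blast
    then have "int n dvd (u * v - 1) * y" by (simp add: cong_iff_dvd_diff)
    then have "e' (u * (v * y)) = e' y" unfolding e'.e_eq_iff by (simp add: algebra_simps)
    then show ?thesis by metis
  qed
  have image: "e' ` (\<lambda>x. u * x) ` D = e' ` D'"
  proof -
    have "e' ` (\<lambda>x. u * x) ` D = e' ` (\<lambda>x. (u * x) mod int n) ` D" by (simp add: image_image)
    also have "\<dots> = e' ` D'" unfolding D by (simp add: image_image)
    finally show ?thesis .
  qed
  have inj: "e x = e y" if "e' (u * x) = e' (u * y)" for x y
  proof -
    have "int n dvd u * (x - y)" using that unfolding e'.e_eq_iff by (simp add: right_diff_distrib)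
    then show ?thesis using assms(3) unfolding e.e_eq_iff
      by (simp add: coprime_commute coprime_dvd_mult_right_iff)
  qed
  have arc: "(e x, e y) \<in> parcs (cayley_graph G (e ` D)) \<longleftrightarrow>
      (\<phi> (e x), \<phi> (e y)) \<in> parcs (cayley_graph H (e' ` D'))" for x y
  proof -
    have "e (y - x) \<in> e ` D \<longleftrightarrow> e' (u * (y - x)) \<in> e' ` (\<lambda>x. u * x) ` D"
    proof
      assume "e (y - x) \<in> e ` D"
      then obtain z where z: "z \<in> D" "e (y - x) = e z" by blast
      then have "e' (u * (y - x)) = e' (u * z)" using \<phi> by metis
      with z(1) show "e' (u * (y - x)) \<in> e' ` (\<lambda>x. u * x) ` D" by blast
    next
      assume "e' (u * (y - x)) \<in> e' ` (\<lambda>x. u * x) ` D"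
      then obtain z where "z \<in> D" "e' (u * (y - x)) = e' (u * z)" by blast
      then show "e (y - x) \<in> e ` D" using inj by blast
    qed
    then show ?thesis
      unfolding \<phi> image by (simp add: e.parcs_cayley e'.parcs_cayley right_diff_distrib image_mono)
  qed
  show ?thesis
  proof (rule digraph_iso_with_projI)
    show "parcs (cayley_graph G (e ` D)) \<subseteq> pverts (cayley_graph G (e ` D)) \<times> pverts (cayley_graph G (e ` D))"
      using e.parcs_cayley_subset by simp
    show "inj_on \<phi> (pverts (cayley_graph G (e ` D)))"
      by (auto simp: inj_on_def \<phi> intro: inj)
    show verts: "pverts (cayley_graph H (e' ` D')) = \<phi> ` pverts (cayley_graph G (e ` D))"
      using surj by (auto simp: \<phi> image_iff)
    show "parcs (cayley_graph H (e' ` D')) = map_prod \<phi> \<phi> ` parcs (cayley_graph G (e ` D))"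
    proof (intro equalityI subsetI)
      fix p assume p: "p \<in> parcs (cayley_graph H (e' ` D'))"
      then obtain v w where "p = (e' v, e' w)" using e'.parcs_cayley_subset by blast
      then obtain x y where "p = (\<phi> (e x), \<phi> (e y))" using surj \<phi> by metis
      then show "p \<in> map_prod \<phi> \<phi> ` parcs (cayley_graph G (e ` D))"
        using p arc by (intro image_eqI[of _ _ "(e x, e y)"]) auto
    next
      fix p assume "p \<in> map_prod \<phi> \<phi> ` parcs (cayley_graph G (e ` D))"
      then obtain v w where vw: "p = (\<phi> v, \<phi> w)" "(v, w) \<in> parcs (cayley_graph G (e ` D))" by auto
      then obtain x y where "v = e x" "w = e y" using e.parcs_cayley_subset by blast
      with vw arc show "p \<in> parcs (cayley_graph H (e' ` D'))" by simp
    qed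
  qed
qed

text \<open>Negation is an involution on the connection set whose only possible fixed point is
  \<^term>\<open>n div 2\<close>, so an odd valency forces \<^term>\<open>n div 2\<close> to occur.\<close>

lemma valency_five_connection_set:
  fixes T :: "int set" and n :: nat
  assumes "T \<subseteq> {0<..<int n}" "card T = 5" "\<And>x. x \<in> T \<Longrightarrow> int n - x \<in> T"
  obtains a b m where "int n = 2 * m" "0 < a" "a < m" "0 < b" "b < m" "a \<noteq> b"
    "T = {a, int n - a, b, int n - b, m}"
proof -
  define A where "A = {x \<in> T. 2 * x < int n}"
  define B where "B = {x \<in> T. 2 * x > int n}"
  define C where "C = {x \<in> T. 2 * x = int n}"
  have fin: "finite T" using assms(2) by (metis card.infinite zero_neq_numeral)
  then have finABC: "finite A" "finite B" "finite C" unfolding A_def B_def C_def by auto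
  have T: "T = A \<union> B \<union> C" unfolding A_def B_def C_def by auto
  have B: "B = (\<lambda>x. int n - x) ` A"
  proof (intro equalityI subsetI)
    fix x assume "x \<in> B"
    then show "x \<in> (\<lambda>x. int n - x) ` A"
      using assms(3) unfolding A_def B_def by (intro image_eqI[of _ _ "int n - x"]) auto
  qed (use assms(3) in \<open>auto simp: A_def B_def\<close>)
  have "card B = card A" unfolding B by (intro card_image) (auto simp: inj_on_def)
  moreover have "card T = card A + card B + card C"
    unfolding T using finABC by (subst card_Un_disjoint card_Un_disjoint) (auto simp: A_def B_def C_def card_Un_disjoint disjoint_iff)
  moreover have C1: "C \<subseteq> {int n div 2}" unfolding C_def by auto
  then have "card C \<le> 1" using card_mono[of "{int n div 2}" C] by simp
  \<comment> \<open>By parity the fixed part \<open>C\<close> is nonempty, which leaves two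
    pairs.\<close>
  ultimately have "card A + card A + card C = 5" "card C \<le> 1" using assms(2) by simp_all
  then have card: "card A = 2" "card C = 1" by presburger+
  obtain a b where ab: "A = {a, b}" "a \<noteq> b" using card(1) by (meson card_2_iff)
  obtain m where m: "C = {m}" using card(2) card_1_singletonE by blast
  then have n: "int n = 2 * m" unfolding C_def by auto
  have "0 < x \<and> x < m" if "x \<in> A" for x using that assms(1) n unfolding A_def by auto
  then have "0 < a" "a < m" "0 < b" "b < m" using ab by auto
  moreover have "T = {a, int n - a, b, int n - b, m}" unfolding T B m ab by auto
  ultimately show ?thesis using that n ab(2) by blast
qed

lemma connection_set_valency_five:
  assumes "group G" "cyclic_parametrization G e n" "connection_set G S" "card S = 5"
  obtains a b m where "int n = 2 * m" "S = e ` {a, - a, b, - b, m}"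
    "\<not> m dvd a" "\<not> m dvd b" "\<not> 2 * m dvd a - b" "\<not> 2 * m dvd a + b"
proof -
  interpret group G by fact
  interpret e: cyclic_parametrization G e n by fact
  have S: "S \<subseteq> carrier G" "\<one>\<^bsub>G\<^esub> \<notin> S" "\<And>s. s \<in> S \<Longrightarrow> inv\<^bsub>G\<^esub> s \<in> S"
    using assms(3) by (auto simp: connection_set_def)
  have e_in: "e x \<in> carrier G" for x unfolding e.carrier_eq by simp
  have e0: "e 0 = \<one>\<^bsub>G\<^esub>"
    using e.e_add[of 0 0] e_in[of 0] by (simp add: r_cancel_one)
  have e_inv: "inv\<^bsub>G\<^esub> (e x) = e (- x)" for x
    using e_in by (intro inv_equality) (simp_all add: e.e_add e0)
  define T where "T = {x \<in> {0..<int n}. e x \<in> S}"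
  have ST: "S = e ` T" using S(1) unfolding T_def e.carrier_eq_image by auto
  have "inj_on e T" using e.inj_on_e by (rule inj_on_subset) (auto simp: T_def)
  then have "card T = 5" using assms(4) ST by (metis card_image)
  moreover have "T \<subseteq> {0<..<int n}"
  proof
    fix x assume x: "x \<in> T"
    then have "x \<noteq> 0" using S(2) e0 unfolding T_def by auto
    with x show "x \<in> {0<..<int n}" unfolding T_def by auto
  qed
  moreover have "int n - x \<in> T" if "x \<in> T" for x
  proof -
    have "e (int n - x) = e (- x)" by (simp add: e.e_eq_iff)
    moreover have "e (- x) \<in> S" using S(3)[of "e x"] that e_inv unfolding T_def by simp
    ultimately show ?thesis using that \<open>T \<subseteq> {0<..<int n}\<close> unfolding T_def by auto
  qed
  ultimately obtain a b m where abm: "int n = 2 * m" "0 < a" "a < m" "0 < b" "b < m" "a \<noteq> b"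
    "T = {a, int n - a, b, int n - b, m}"
    using valency_five_connection_set by metis
  have "e (int n - x) = e (- x)" for x by (simp add: e.e_eq_iff)
  then have "S = e ` {a, - a, b, - b, m}" unfolding ST abm(7) by simp
  moreover have "\<not> m dvd a" "\<not> m dvd b" "\<not> 2 * m dvd a + b" using abm zdvd_not_zless by auto
  moreover have "\<not> 2 * m dvd a - b"
  proof
    assume "2 * m dvd a - b"
    then have "2 * m \<le> \<bar>a - b\<bar>" using abm(6) by (intro zdvd_imp_le) auto
    then show False using abm by linarith
  qed
  ultimately show ?thesis using that abm(1) by blast
qed

lemma normalizes_to_condition_of_magic:
  assumes "cyclic_parametrization G e n" "int n = 2 * m"
    and nd: "\<not> m dvd a" "\<not> m dvd b" "\<not> 2 * m dvd a - b" "\<not> 2 * m dvd a + b"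
    and "Digraph_Component.connected (with_proj (cayley_graph G (e ` {a, - a, b, - b, m})))"
    and "closed_distance_magic (cayley_graph G (e ` {a, - a, b, - b, m}))"
  shows "normalizes_to_condition m a b"
proof -
  interpret e: cyclic_parametrization G e n by fact
  define k where "k = nat m"
  have k: "int k = m" "k > 0" "n = 2 * k" using assms(2) e.n_pos unfolding k_def by auto
  obtain l r where l: "bij_betw l (range e) {1..n}"
    "\<And>x. l (e x) + l (e (x + m)) + l (e (x + a)) + l (e (x - a)) + l (e (x + b)) + l (e (x - b)) = r"
    using assms(8) unfolding closed_distance_magic_def e.closed_distance_magic_labeling_cayley[OF assms(2) nd] by blast
  \<comment> \<open>Centering: the six terms add up to \<open>6 * r - 6 * r\<close>. The factor 6
    avoids dividing \<open>r\<close>.\<close>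
  define f where "f x = 6 * int (l (e x)) - int r" for x
  have sum: "f x + f (x + int k) + f (x + a) + f (x - a) + f (x + b) + f (x - b) = 0" for x
    unfolding k(1) using l(2)[of x] unfolding f_def by linarith
  have periodic: "f (x + int (2 * k) * y) = f x" for x y
  proof -
    have "e (x + int (2 * k) * y) = e x" by (simp add: e.e_eq_iff k(3))
    then show ?thesis unfolding f_def by simp
  qed
  have inj: "int (2 * k) dvd x - y" if "f x = f y" for x y
  proof -
    have "l (e x) = l (e y)" using that unfolding f_def by simp
    then have "e x = e y" using l(1) by (meson bij_betw_imp_inj_on inj_onD rangeI)
    then show ?thesis unfolding e.e_eq_iff k(3) .
  qed
  have "gcd a (gcd b m) = 1"
  proof -
    have "is_unit (gcd a (gcd b m))"
      using assms(7)
    proof (rule e.connected_cayley_imp_coprime)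
      show "gcd a (gcd b m) dvd int n" unfolding assms(2) by (meson dvd_mult gcd_dvd2 dvd_trans)
      fix x assume "x \<in> {a, - a, b, - b, m}"
      moreover have "gcd a (gcd b m) dvd b" "gcd a (gcd b m) dvd m" by (meson gcd_dvd1 gcd_dvd2 dvd_trans)+
      ultimately show "gcd a (gcd b m) dvd x" by auto
    qed
    then show ?thesis by (simp add: is_unit_gcd)
  qed
  moreover have "\<exists>j. \<not> int p dvd j \<and> magic_frequency m a b j" if "prime p" "int p dvd 2 * m" for p
  proof -
    have "p dvd 2 * k" using that(2) k(1) by (metis int_dvd_int_iff of_nat_mult of_nat_numeral)
    then show ?thesis
      using magic_frequency_not_dvd[OF k(2) periodic inj sum that(1)] k(1) by metis
  qed
  moreover have "m > 0" using k(1,2) by simp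
  ultimately show ?thesis
    by (intro normalizes_to_condition_of_frequencies nd)
qed

section \<open>Labelings and the classification\<close>

text \<open>A labeling lifted to the integers; the equivalence expresses periodicity and injectivity
  on residues at once.\<close>

definition integer_magic :: "int \<Rightarrow> int \<Rightarrow> (int \<Rightarrow> int) \<Rightarrow> bool" where
  "integer_magic m c F \<longleftrightarrow>
    (\<forall>x. 1 \<le> F x \<and> F x \<le> 2 * m) \<and> (\<forall>x y. F x = F y \<longleftrightarrow> 2 * m dvd x - y) \<and>
    (\<exists>r. \<forall>x. F x + F (x + m) + F (x + 1) + F (x - 1) + F (x + c) + F (x - c) = r)"

text \<open>A bijection from the residues modulo \<^term>\<open>2 * q\<close> onto \<^term>\<open>{0..<2 * q}\<close> that is
  complementary on antipodal residues.\<close>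

definition antipodal_index :: "int \<Rightarrow> int \<Rightarrow> int" where
  "antipodal_index q x = (let y = x mod (2 * q) in if y < q then y else 3 * q - 1 - y)"

lemma antipodal_index_bounds:
  assumes "q > 0"
  shows "0 \<le> antipodal_index q x" "antipodal_index q x < 2 * q"
proof -
  obtain y where "y = x mod (2 * q)" "0 \<le> y" "y < 2 * q" using assms by simp
  then show "0 \<le> antipodal_index q x" "antipodal_index q x < 2 * q"
    by (auto simp: antipodal_index_def Let_def simp del: pos_mod_sign pos_mod_bound)
qed

lemma antipodal_index_eq_iff:
  assumes "q > 0"
  shows "antipodal_index q x = antipodal_index q y \<longleftrightarrow> 2 * q dvd x - y"
proof -
  have "(if u < q then u else 3 * q - 1 - u) = (if v < q then v else 3 * q - 1 - v) \<longleftrightarrow> u = v"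
    if "0 \<le> u" "u < 2 * q" "0 \<le> v" "v < 2 * q" for u v
    using that by auto
  from this[of "x mod (2 * q)" "y mod (2 * q)"]
  have "antipodal_index q x = antipodal_index q y \<longleftrightarrow> x mod (2 * q) = y mod (2 * q)"
    using assms by (simp add: antipodal_index_def Let_def)
  then show ?thesis by (simp only: mod_eq_dvd_iff)
qed

lemma antipodal_index_add:
  assumes "q > 0"
  shows "antipodal_index q x + antipodal_index q (x + q) = 2 * q - 1"
proof -
  obtain y where y: "y = x mod (2 * q)" "0 \<le> y" "y < 2 * q" using assms by simp
  \<comment> \<open>The reduced residue of \<open>x + q\<close>; exactly one of \<open>y\<close> and
    \<open>z\<close> lies below \<open>q\<close>.\<close>
  define z where "z = (if y < q then y + q else y - q)"
  have "2 * q dvd x - y" unfolding y(1) by (simp add: mod_eq_dvd_iff[symmetric])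
  then have "2 * q dvd (x + q) - z"
    by (auto simp: z_def dvd_add_left_iff algebra_simps elim: dvd_add_times_triv_right_iff[THEN iffD2])
  then have "(x + q) mod (2 * q) = z mod (2 * q)" by (simp only: mod_eq_dvd_iff)
  also have "\<dots> = z" using y(2,3) by (intro mod_pos_pos_trivial) (auto simp: z_def)
  finally show ?thesis using y unfolding antipodal_index_def z_def Let_def by auto
qed

text \<open>With \<open>c = m - 1\<close> a closed neighborhood consists of three antipodal pairs:
  \<open>x\<close> with \<open>x + m\<close>, \<open>x - 1\<close> with \<open>x + c\<close>, and
  \<open>x - c\<close> with \<open>x + 1\<close>.\<close>

lemma integer_magic_antipodal:
  assumes "m > 0"
  shows "\<exists>F. integer_magic m (m - 1) F"
proof -
  define F where "F x = antipodal_index m x + 1" for x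
  have pair: "F x + F (x + m) = 2 * m + 1" for x
    using antipodal_index_add[OF assms, of x] by (simp add: F_def)
  have "F x + F (x + m) + F (x + 1) + F (x - 1) + F (x + (m - 1)) + F (x - (m - 1)) = 3 * (2 * m + 1)" for x
    using pair[of x] pair[of "x - 1"] pair[of "x - (m - 1)"] by (simp add: algebra_simps)
  moreover have "1 \<le> F x \<and> F x \<le> 2 * m" for x
    using antipodal_index_bounds[OF assms, of x] by (simp add: F_def)
  moreover have "F x = F y \<longleftrightarrow> 2 * m dvd x - y" for x y
    using antipodal_index_eq_iff[OF assms] by (simp add: F_def)
  ultimately show ?thesis unfolding integer_magic_def by blast
qed

text \<open>By the Chinese remainder theorem the residue of \<^term>\<open>x\<close> modulo \<^term>\<open>m\<close> is the pair of its
  residues modulo \<^term>\<open>d1\<close> and \<^term>\<open>d2\<close>, where \<^term>\<open>c\<close> acts as \<^term>\<open>1::int\<close> on the first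
  and as \<^term>\<open>- 1::int\<close> on the second.\<close>

lemma integer_magic_odd:
  assumes "m > 0" "odd m" "even c" "m dvd c\<^sup>2 - 1"
  shows "\<exists>F. integer_magic m c F"
proof -
  have "c\<^sup>2 - 1 = (c - 1) * (c + 1)" by (simp add: power2_eq_square algebra_simps)
  then obtain d d' where d': "m = d * d'" "d dvd c - 1" "d' dvd c + 1"
    using division_decomp[of m "c - 1" "c + 1"] assms(4) by metis
  define d1 d2 where "d1 = \<bar>d\<bar>" and "d2 = \<bar>d'\<bar>"
  have d: "m = d1 * d2" "d1 dvd c - 1" "d2 dvd c + 1" "d1 > 0" "d2 > 0"
    using assms(1) d' unfolding d1_def d2_def by (auto simp flip: abs_mult)
  have "coprime d1 d2"
  proof (rule coprimeI)
    fix p assume p: "p dvd d1" "p dvd d2"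
    then have "p dvd (c + 1) - (c - 1)" using d(2,3) by (meson dvd_diff dvd_trans)
    then have "p dvd 2" by simp
    moreover have "odd p" using p(1) d(1) assms(2) by (metis dvd_mult2 dvd_trans)
    then have "coprime p 2" by simp
    ultimately show "is_unit p" by (meson coprime_common_divisor dvd_refl)
  qed
  \<comment> \<open>The pair of residues is read as a two-digit number below \<open>m\<close>. Even
    arguments get the upper half of the labels in increasing order, odd ones the lower half in
    decreasing order. As \<open>m\<close> is odd, \<open>x\<close> and \<open>x + m\<close> are then
    complementary.\<close>
  define v where "v x = x mod d2 + d2 * (x mod d1)" for x
  define F where "F x = (if even x then m + 1 + v x else m - v x)" for x
  have v: "0 \<le> v x" "v x < m" for x
  proof -
    have "d2 * (x mod d1) \<le> d2 * (d1 - 1)" using d(4,5) by (intro mult_left_mono) auto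
    moreover have "d2 * (d1 - 1) = m - d2" by (simp add: d(1) algebra_simps)
    moreover have "x mod d2 < d2" using d(5) by simp
    ultimately show "v x < m" unfolding v_def by linarith
    show "0 \<le> v x" unfolding v_def using d(4,5) by simp
  qed
  have v_eq: "v x = v y \<longleftrightarrow> m dvd x - y" for x y
  proof
    assume "v x = v y"
    then have "v x mod d2 = v y mod d2" "v x div d2 = v y div d2" by simp_all
    then have "x mod d2 = y mod d2" "x mod d1 = y mod d1" using d(5) by (simp_all add: v_def)
    then have "d2 dvd x - y" "d1 dvd x - y" by (simp_all only: mod_eq_dvd_iff)
    then show "m dvd x - y" unfolding d(1) using \<open>coprime d1 d2\<close> by (intro divides_mult)
  next
    assume "m dvd x - y"
    then have "d2 dvd x - y" "d1 dvd x - y" unfolding d(1) by (meson dvd_mult_left dvd_mult_right)+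
    then have "x mod d2 = y mod d2" "x mod d1 = y mod d1" by (simp_all only: mod_eq_dvd_iff)
    then show "v x = v y" by (simp add: v_def)
  qed
  have bound: "1 \<le> F x \<and> F x \<le> 2 * m" for x using v[of x] by (auto simp: F_def)
  have inj: "F x = F y \<longleftrightarrow> 2 * m dvd x - y" for x y
  proof -
    have "F x = F y \<longleftrightarrow> (even x \<longleftrightarrow> even y) \<and> v x = v y"
      using v[of x] v[of y] by (auto simp: F_def)
    also have "\<dots> \<longleftrightarrow> 2 dvd x - y \<and> m dvd x - y" unfolding v_eq by auto
    also have "\<dots> \<longleftrightarrow> 2 * m dvd x - y"
      using assms(2) by (auto intro!: divides_mult dest: dvd_mult_left dvd_mult_right)
    finally show ?thesis .
  qed
  \<comment> \<open>Modulo \<open>d1\<close> the shifts by \<open>c\<close> and 1 agree, modulo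
    \<open>d2\<close> those by \<open>c\<close> and -1. As \<open>c\<close> is even, the two sides
    occur in \<open>F\<close> with opposite signs and cancel.\<close>
  have v_shift: "v (x + c) + v (x - c) = v (x + 1) + v (x - 1)" for x
  proof -
    have "(x + c) mod d1 = (x + 1) mod d1" "(x - c) mod d1 = (x - 1) mod d1"
      "(x + c) mod d2 = (x - 1) mod d2" "(x - c) mod d2 = (x + 1) mod d2"
      using d(2,3) dvd_minus_iff[of d1 "c - 1"] dvd_minus_iff[of d2 "c + 1"]
      by (simp_all add: mod_eq_dvd_iff algebra_simps)
    then show ?thesis by (simp add: v_def)
  qed
  have "F x + F (x + m) + F (x + 1) + F (x - 1) + F (x + c) + F (x - c) = 6 * m + 3" for x
  proof -
    have "v (x + m) = v x" unfolding v_eq by simp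
    then show ?thesis using v_shift[of x] assms(2,3) by (auto simp: F_def)
  qed
  with bound inj show ?thesis unfolding integer_magic_def by blast
qed

lemma sum_mod_three: "x mod 3 + (x + 1) mod 3 + (x - 1) mod 3 = (3 :: int)"
  by presburger

text \<open>Coprimality of 3 and \<open>2 * q\<close> makes \<open>F\<close> injective on residues.
  Modulo \<open>2 * q\<close> the closed neighborhood splits into three antipodal pairs, and modulo
  3 it covers each residue twice, so both parts of \<open>F\<close> have constant sums.\<close>

lemma integer_magic_six:
  assumes "q > 0" "even q" "e = 1 \<or> e = - 1" "q mod 3 = (- e) mod 3"
  shows "\<exists>F. integer_magic (3 * q) (q - e) F"
proof -
  define L where "L = antipodal_index q"
  define F where "F x = 3 * L x + x mod 3 + 1" for x
  have L: "0 \<le> L x \<and> L x < 2 * q" for x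
    using antipodal_index_bounds[OF assms(1)] by (simp add: L_def)
  have L_eq: "L x = L y \<longleftrightarrow> 2 * q dvd x - y" for x y
    using antipodal_index_eq_iff[OF assms(1)] by (simp add: L_def)
  have pair: "L x + L (x + q) = 2 * q - 1" for x
    using antipodal_index_add[OF assms(1)] by (simp add: L_def)
  have bound: "1 \<le> F x \<and> F x \<le> 2 * (3 * q)" for x
    using L[of x] pos_mod_bound[of 3 x] pos_mod_sign[of 3 x] unfolding F_def by linarith
  have "\<not> 3 dvd q" using assms(3,4) by (elim disjE) presburger+
  then have "\<not> 3 dvd 2 * q" by presburger
  then have cop: "coprime (3 :: int) (2 * q)" by (intro prime_imp_coprime) auto
  have inj: "F x = F y \<longleftrightarrow> 2 * (3 * q) dvd x - y" for x y
  proof -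
    have "F x = F y \<longleftrightarrow> L x = L y \<and> x mod 3 = y mod 3" unfolding F_def by presburger
    also have "\<dots> \<longleftrightarrow> 2 * q dvd x - y \<and> 3 dvd x - y" unfolding L_eq by (simp only: mod_eq_dvd_iff)
    also have "\<dots> \<longleftrightarrow> 3 * (2 * q) dvd x - y"
      using cop divides_mult[of 3 "x - y" "2 * q"] dvd_mult_left dvd_mult_right by blast
    finally show ?thesis by (simp add: mult.left_commute)
  qed
  have L_sum: "L x + L (x + 3 * q) + L (x + 1) + L (x - 1) + L (x + (q - e)) + L (x - (q - e)) = 3 * (2 * q - 1)" for x
  proof -
    have "L (x + 3 * q) = L (x + q)" unfolding L_eq by simp
    with assms(3) show ?thesis
    proof (elim disjE)
      assume "e = 1"
      with \<open>L (x + 3 * q) = L (x + q)\<close> show ?thesis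
        using pair[of x] pair[of "x - 1"] pair[of "x - (q - 1)"] by (simp add: algebra_simps)
    next
      assume "e = - 1"
      with \<open>L (x + 3 * q) = L (x + q)\<close> show ?thesis
        using pair[of x] pair[of "x + 1"] pair[of "x - (q + 1)"] by (simp add: algebra_simps)
    qed
  qed
  have mod_sum: "x mod 3 + (x + 3 * q) mod 3 + (x + 1) mod 3 + (x - 1) mod 3 +
      (x + (q - e)) mod 3 + (x - (q - e)) mod 3 = 6" for x
  proof -
    \<comment> \<open>Thus \<open>q - e\<close> is \<open>- 2 * e\<close>, that is \<open>e\<close>,
      modulo 3.\<close>
    have "3 dvd q + e" using assms(4) mod_eq_dvd_iff[of q 3 "- e"] by simp
    then have "3 dvd (q + e) - 3 * e" by (intro dvd_diff) auto
    then have "(x + (q - e)) mod 3 = (x + e) mod 3" "(x - (q - e)) mod 3 = (x - e) mod 3"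
      using dvd_minus_iff[of 3 "q - 2 * e"] unfolding mod_eq_dvd_iff by (simp_all add: algebra_simps)
    moreover have "(x + e) mod 3 + (x - e) mod 3 = (x + 1) mod 3 + (x - 1) mod 3"
      using assms(3) by auto
    moreover have "(x + 3 * q) mod 3 = x mod 3" by simp
    ultimately show ?thesis using sum_mod_three[of x] by linarith
  qed
  have "F x + F (x + 3 * q) + F (x + 1) + F (x - 1) + F (x + (q - e)) + F (x - (q - e)) = 18 * q + 3" for x
  proof -
    have "3 * a\<^sub>1 + b\<^sub>1 + 1 + (3 * a\<^sub>2 + b\<^sub>2 + 1) + (3 * a\<^sub>3 + b\<^sub>3 + 1) + (3 * a\<^sub>4 + b\<^sub>4 + 1) +
        (3 * a\<^sub>5 + b\<^sub>5 + 1) + (3 * a\<^sub>6 + b\<^sub>6 + 1) =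
        3 * (a\<^sub>1 + a\<^sub>2 + a\<^sub>3 + a\<^sub>4 + a\<^sub>5 + a\<^sub>6) + (b\<^sub>1 + b\<^sub>2 + b\<^sub>3 + b\<^sub>4 + b\<^sub>5 + b\<^sub>6) + 6"
      for a\<^sub>1 a\<^sub>2 a\<^sub>3 a\<^sub>4 a\<^sub>5 a\<^sub>6 b\<^sub>1 b\<^sub>2 b\<^sub>3 b\<^sub>4 b\<^sub>5 b\<^sub>6 :: int
      by simp
    then show ?thesis unfolding F_def by (simp only: L_sum mod_sum) simp
  qed
  with bound inj show ?thesis unfolding integer_magic_def by blast
qed

text \<open>The converse of \<open>family_decomp\<close>: modulo 3 the signs
  \<open>(- 1) ^ (t - 1)\<close> and \<open>(- 1) ^ t\<close> multiply to -1.\<close>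

lemma power_two_times_mod_three:
  fixes e k :: int
  assumes "t \<ge> 1"
  shows "(2 ^ (t - 1) * (6 * k + e * (- 1) ^ t)) mod 3 = (- e) mod 3"
proof -
  have sign: "(- 1 :: int) ^ (t - 1) * (- 1) ^ t = - 1"
    using assms by (cases t) (auto simp flip: power_mult_distrib)
  have "(2 ^ (t - 1) * (6 * k + e * (- 1) ^ t)) mod 3 =
      ((2 ^ (t - 1) mod 3) * ((6 * k + e * (- 1) ^ t) mod 3)) mod 3"
    by (simp only: mod_mult_eq)
  also have "(6 * k + e * (- 1) ^ t) mod 3 = (e * (- 1) ^ t) mod 3"
    unfolding mod_eq_dvd_iff by simp
  also have "((2 ^ (t - 1) mod 3) * ((e * (- 1) ^ t) mod 3)) mod 3 = ((- 1) ^ (t - 1) * (e * (- 1) ^ t)) mod 3"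
    unfolding power_two_mod_three by (simp only: mod_mult_eq)
  also have "(- 1) ^ (t - 1) * (e * (- 1) ^ t) = e * ((- 1) ^ (t - 1) * (- 1) ^ t)"
    by (simp only: mult.left_commute)
  finally show ?thesis unfolding sign by simp
qed

section \<open>From the four alternatives to labelings, and the equivalence\<close>

lemma integer_magic_of_circulant_condition:
  assumes "m > 0" "circulant_condition (2 * m) c"
  shows "\<exists>F. integer_magic m c F"
proof -
  \<comment> \<open>The last two alternatives are handled together, with \<open>e = 1\<close> and
    \<open>e = - 1\<close>.\<close>
  have six: "\<exists>F. integer_magic m c F"
    if "t \<ge> 2" "2 * m = 3 * 2 ^ t * (6 * k + e * (- 1) ^ t)" "c = 2 ^ (t - 1) * (6 * k + e * (- 1) ^ t) - e"
      "e = 1 \<or> e = - 1" for t :: nat and k e :: int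
  proof -
    define q where "q = 2 ^ (t - 1) * (6 * k + e * (- 1) ^ t)"
    have "(2 :: int) ^ t = 2 * 2 ^ (t - 1)" using that(1) by (cases t) auto
    then have "m = 3 * q" using that(2) unfolding q_def by simp
    moreover have "even q" using that(1) unfolding q_def by simp
    moreover have "q mod 3 = (- e) mod 3"
      unfolding q_def using that(1) by (intro power_two_times_mod_three) simp
    ultimately show ?thesis
      using integer_magic_six[of q e] that(3,4) assms(1) by (simp add: q_def)
  qed
  from assms(2) show ?thesis
    unfolding circulant_condition_def
  proof (elim disjE conjE exE)
    assume "c = 2 * m div 2 - 1"
    then show ?thesis using integer_magic_antipodal[OF assms(1)] by simp
  next
    fix s assume *: "[2 * m = 2] (mod 4)" "even c" "odd s" "2 * (c\<^sup>2 - 1) = s * (2 * m)"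
    have "4 dvd 2 * (m - 1)" using *(1) unfolding cong_iff_dvd_diff by (simp add: right_diff_distrib)
    then have "odd m" by presburger
    moreover have "2 * (c\<^sup>2 - 1) = 2 * (m * s)" using *(4) by (simp only: mult_ac)
    then have "c\<^sup>2 - 1 = m * s" by (metis mult_left_cancel zero_neq_numeral)
    then have "m dvd c\<^sup>2 - 1" by simp
    ultimately show ?thesis using integer_magic_odd assms(1) *(2) by blast
  next
    fix t :: nat and k :: int
    assume "2 \<le> t" "2 * m = 3 * 2 ^ t * (6 * k + (- 1) ^ t)" "c = 2 ^ (t - 1) * (6 * k + (- 1) ^ t) - 1"
    then show ?thesis by (intro six[of t k 1]) simp_all
  next
    fix t :: nat and k :: int
    assume "2 \<le> t" "2 * m = 3 * 2 ^ t * (6 * k - (- 1) ^ t)" "c = 2 ^ (t - 1) * (6 * k - (- 1) ^ t) + 1"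
    then show ?thesis by (intro six[of t k "- 1"]) simp_all
  qed
qed

lemma not_dvd_of_lt:
  fixes m c :: int
  assumes "1 < c" "c < m"
  shows "\<not> m dvd 1" "\<not> m dvd c" "\<not> 2 * m dvd 1 - c" "\<not> 2 * m dvd 1 + c"
proof -
  show "\<not> m dvd 1" "\<not> m dvd c" "\<not> 2 * m dvd 1 + c" using assms zdvd_not_zless by auto
  have "\<not> 2 * m dvd c - 1" using assms zdvd_not_zless by auto
  then show "\<not> 2 * m dvd 1 - c" using dvd_minus_iff[of "2 * m" "c - 1"] by simp
qed

lemma closed_distance_magic_integer_mod_group:
  fixes m c :: int
  assumes "1 < c" "c < m" "circulant_condition (2 * m) c"
  shows "closed_distance_magic (cayley_graph (integer_mod_group (nat (2 * m)))
    ((\<lambda>x. x mod (2 * m)) ` {1, - 1, c, - c, m}))"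
proof -
  define n where "n = nat (2 * m)"
  have n: "int n = 2 * m" "n > 0" using assms unfolding n_def by auto
  interpret cyclic_parametrization "integer_mod_group n" "\<lambda>x. x mod int n" n
    using n(2) by (rule cyclic_parametrization_integer_mod_group)
  have "m > 0" using assms(1,2) by simp
  then obtain F where "integer_magic m c F"
    using integer_magic_of_circulant_condition assms(3) by blast
  then obtain r where F: "\<And>x. 1 \<le> F x \<and> F x \<le> 2 * m" "\<And>x y. F x = F y \<longleftrightarrow> 2 * m dvd x - y"
    "\<And>x. F x + F (x + m) + F (x + 1) + F (x - 1) + F (x + c) + F (x - c) = r"
    unfolding integer_magic_def by blast
  have F_mod: "F (x mod int n) = F x" for x
    unfolding F(2) using n(1) by (simp add: mod_eq_dvd_iff[symmetric])
  define l where "l x = nat (F x)" for x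
  have l: "int (l x) = F x" for x unfolding l_def using F(1)[of x] by simp
  have range: "range (\<lambda>x. x mod int n) = {0..<int n}"
    using carrier_eq n(2) by (simp add: carrier_integer_mod_group)
  have "bij_betw l (range (\<lambda>x. x mod int n)) {1..n}"
  proof -
    have inj: "inj_on l {0..<int n}"
    proof (rule inj_onI)
      fix x y assume *: "x \<in> {0..<int n}" "y \<in> {0..<int n}" "l x = l y"
      then have "F x = F y" using l by metis
      then have "x mod int n = y mod int n" unfolding F(2) n(1) by (simp only: mod_eq_dvd_iff)
      with * show "x = y" by simp
    qed
    moreover have "l ` {0..<int n} \<subseteq> {1..n}"
    proof
      fix y assume "y \<in> l ` {0..<int n}"
      then obtain x where "y = l x" by blast
      then have "1 \<le> int y" "int y \<le> int n" using F(1)[of x] l[of x] n(1) by auto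
      then show "y \<in> {1..n}" by simp
    qed
    moreover have "card (l ` {0..<int n}) = card {1..n}" using inj by (simp add: card_image)
    ultimately show ?thesis unfolding range bij_betw_def by (simp add: card_subset_eq)
  qed
  moreover have "l (x mod int n) + l ((x + m) mod int n) + l ((x + 1) mod int n) + l ((x - 1) mod int n) +
      l ((x + c) mod int n) + l ((x - c) mod int n) = nat r" for x
  proof -
    have "int (l (x mod int n) + l ((x + m) mod int n) + l ((x + 1) mod int n) + l ((x - 1) mod int n) +
        l ((x + c) mod int n) + l ((x - c) mod int n)) = r"
      using F(3)[of x] by (simp only: of_nat_add l F_mod)
    then show ?thesis by linarith
  qed
  moreover have "nat r > 0" using F(1)[of 0] F(1)[of m] F(1)[of 1] F(1)[of "- 1"] F(1)[of c] F(1)[of "- c"] F(3)[of 0] by simp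
  ultimately have "closed_distance_magic (cayley_graph (integer_mod_group n) ((\<lambda>x. x mod int n) ` {1, - 1, c, - c, m}))"
    unfolding closed_distance_magic_def
      closed_distance_magic_labeling_cayley[OF n(1) not_dvd_of_lt[OF assms(1,2)]]
    by blast
  then show ?thesis unfolding n_def[symmetric] n(1) .
qed

theorem theorem1p2:
  fixes G :: "('a, 'm) monoid_scheme" and S :: "'a set" and \<Gamma> :: "'a pair_pre_digraph"
  assumes "group G" and "finite (carrier G)" and "cyclic_group G"
    and "connection_set G S"
    and "\<Gamma> = cayley_graph G S"
    and "card S = 5"
    and "Digraph_Component.connected (with_proj \<Gamma>)"
  shows "closed_distance_magic \<Gamma> \<longleftrightarrow>
    (\<exists>(n::int) (c::int). even n \<and> 1 < c \<and> c < n div 2 \<and>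
       digraph_iso (with_proj \<Gamma>)
         (with_proj (cayley_graph (integer_mod_group (nat n))
            ((\<lambda>x. x mod n) ` {1, -1, c, -c, n div 2}))) \<and>
       (c = n div 2 - 1
        \<or> ([n = 2] (mod 4) \<and> even c \<and> (\<exists>m. odd m \<and> 2 * (c^2 - 1) = m * n))
        \<or> (\<exists>(t::nat) (k::int). t \<ge> 2 \<and> k \<ge> 0 \<and> c \<ge> 2 \<and>
             n = 3 * 2^t * (6 * k + (-1)^t) \<and> c = 2^(t - 1) * (6 * k + (-1)^t) - 1)
        \<or> (\<exists>(t::nat) (k::int). t \<ge> 2 \<and> k \<ge> 0 \<and> c \<ge> 2 \<and>
             n = 3 * 2^t * (6 * k - (-1)^t) \<and> c = 2^(t - 1) * (6 * k - (-1)^t) + 1)))"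
  unfolding circulant_condition_def[symmetric]
proof (intro iffI; (elim exE conjE)?)
  assume magic: "closed_distance_magic \<Gamma>"
  obtain e n where e: "cyclic_parametrization G e n"
    using group.cyclic_parametrization_exists[OF assms(1-3)] by blast
  obtain a b m where abm: "int n = 2 * m" "S = e ` {a, - a, b, - b, m}"
    "\<not> m dvd a" "\<not> m dvd b" "\<not> 2 * m dvd a - b" "\<not> 2 * m dvd a + b"
    using connection_set_valency_five[OF assms(1) e assms(4,6)] .
  have \<Gamma>: "\<Gamma> = cayley_graph G (e ` {a, - a, b, - b, m})" using assms(5) abm(2) by simp
  have "normalizes_to_condition m a b"
    using normalizes_to_condition_of_magic[OF e abm(1,3-6)] assms(7) magic unfolding \<Gamma> by blast
  then obtain u c where uc: "coprime u (2 * m)" "1 < c" "c < m" "circulant_condition (2 * m) c"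
    "(\<lambda>x. (u * x) mod (2 * m)) ` {a, - a, b, - b, m} = (\<lambda>x. x mod (2 * m)) ` {1, - 1, c, - c, m}"
    unfolding normalizes_to_condition_def by blast
  have n: "n > 0" "nat (2 * m) = n" using abm(1) uc(2,3) by linarith+
  have "digraph_iso (with_proj \<Gamma>)
      (with_proj (cayley_graph (integer_mod_group n) ((\<lambda>x. x mod int n) ` {1, - 1, c, - c, m})))"
    unfolding \<Gamma> using e cyclic_parametrization_integer_mod_group[OF n(1)]
    by (rule cayley_iso_of_unit) (use uc abm(1) in simp_all)
  then have "digraph_iso (with_proj \<Gamma>)
      (with_proj (cayley_graph (integer_mod_group (nat (2 * m)))
        ((\<lambda>x. x mod (2 * m)) ` {1, - 1, c, - c, 2 * m div 2})))"
    unfolding n(2) abm(1) by simp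
  with uc show "\<exists>n c. even n \<and> 1 < c \<and> c < n div 2 \<and>
      digraph_iso (with_proj \<Gamma>)
         (with_proj (cayley_graph (integer_mod_group (nat n))
            ((\<lambda>x. x mod n) ` {1, -1, c, -c, n div 2}))) \<and> circulant_condition n c"
    by (intro exI[of _ "2 * m"] exI[of _ c]) simp
next
  fix n c :: int
  assume *: "even n" "1 < c" "c < n div 2"
    "digraph_iso (with_proj \<Gamma>)
         (with_proj (cayley_graph (integer_mod_group (nat n))
            ((\<lambda>x. x mod n) ` {1, -1, c, -c, n div 2})))"
    "circulant_condition n c"
  have "2 * (n div 2) = n" using *(1) by simp
  then have "closed_distance_magic (cayley_graph (integer_mod_group (nat n))
      ((\<lambda>x. x mod n) ` {1, -1, c, -c, n div 2}))"
    using closed_distance_magic_integer_mod_group[OF *(2,3)] *(5) by simp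
  moreover have "parcs \<Gamma> \<subseteq> pverts \<Gamma> \<times> pverts \<Gamma>" by (auto simp: assms(5) cayley_graph_def)
  ultimately show "closed_distance_magic \<Gamma>" using closed_distance_magic_iso[OF *(4)] by blast
qed

end
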